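(* Let $F$ be a nonarchimedean local field of characteristic zero and odd residual characteristic, let $n\ge2$, and let $X=\mathrm{Sp}_{2n}(F)\backslash\mathrm{GL}_{2n}(F)$. Let $\pi$ be an irreducible unitary $\mathrm{Sp}_{2n}(F)$-distinguished representation of $\mathrm{GL}_{2n}(F)$, and let $\psi_\pi:\mathcal{L}_F\times\mathrm{SL}(2,\mathbb{C})\to\mathrm{GL}(2n,\mathbb{C})$ be the $A$-parameter of $\pi$. Then $\psi_\pi$ is $X$-distinguished and $X$-elliptic if and only if $\pi$ is isomorphic to a Speh representation $\mathcal{U}(\delta,2)$ for some discrete series representation $\delta$ of $\mathrm{GL}_n(F)$.
   Context: A representation $\pi$ of $\mathrm{GL}_{2n}(F)$ is $\mathrm{Sp}_{2n}(F)$-distinguished if $\mathrm{Hom}_{\mathrm{Sp}_{2n}(F)}(\pi,1)\ne0$. Let $\nu=|\det(\cdot)|_F$, and let $\times$ denote normalized parabolic induction from standard block-upper-triangular parabolic subgroups. A discrete series representation is an irreducible admissible representation with unitary central character that is square integrable modulo the centre. For a discrete series representation $\delta$ of $\mathrm{GL}_d(F)$ and $m\ge1$, $\mathcal{U}(\delta,m)$ denotes the unique irreducible quotient of $\nu^{(m-1)/2}\delta\times\cdots\times\nu^{(1-m)/2}\delta$; the $\mathcal{U}(\delta,2)$ are the Speh representations. For a representation $\sigma$ and real $\alpha$ with $|\alpha|<1/2$, put $\pi(\sigma,\alpha)=\nu^\alpha\sigma\times\nu^{-\alpha}\sigma$. By Tadić's classification, every irreducible unitary representation of a general linear group over $F$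 is of the form $\mathcal{U}(\delta_1,m_1)\times\cdots\times\mathcal{U}(\delta_l,m_l)\times\pi(\mathcal{U}(\delta_{l+1},m_{l+1}),\alpha_{l+1})\times\cdots\times\pi(\mathcal{U}(\delta_t,m_t),\alpha_t)$ with $\delta_i$ discrete series representations, $m_i\geq 1$, and $0<\alpha_i<1/2$, uniquely up to permutation of the factors. Parameters. $\mathcal{W}_F$ is the Weil group of $F$, $\mathcal{L}_F=\mathcal{W}_F\times\mathrm{SL}(2,\mathbb{C})$, $|\cdot|_{\mathcal{W}_F}$ is the absolute value on $\mathcal{W}_F$ corresponding to $|\cdot|_F$ via the Artin map, and $\mathcal{S}(d)$ is the irreducible $d$-dimensional algebraic representation of $\mathrm{SL}(2,\mathbb{C})$. An $L$-parameter for $\mathrm{GL}_n(F)$ is a continuous homomorphism $\phi:\mathcal{L}_F\to\mathrm{GL}(n,\mathbb{C})$, algebraic on $\mathrm{SL}(2,\mathbb{C})$, with $\phi(\mathcal{W}_F)$ consisting of semisimple elements; it is tempered if $\phi(\mathcal{W}_F)$ is bounded, and elliptic if its image is not contained in any proper Levi subgroup of $\mathrm{GL}(n,\mathbb{C})$. For a discrete series representation $\delta$, let $\phi_\delta$ be its $L$-parameter under the local Langlands correspondence. The $A$-parameter $\psi_\pi$ of the irreducible unitary representation $\pi\cong\mathcal{U}(\delta_1,m_1)\times\cdots\times\mathcal{U}(\delta_l,m_l)\times\pi(\mathcal{U}(\delta_{l+1},m_{l+1}),\alpha_{l+1})\times\cdots\times\pi(\mathcal{U}(\delta_t,m_t),\alpha_t)$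 (with $\delta_i$ discrete series representations, $m_i\ge1$, and $0<\alpha_i<1/2$) is the homomorphism (up to equivalence, and not required to be bounded on $\mathcal{W}_F$) $$\bigoplus_{i=1}^{l}\phi_{\delta_i}\otimes\mathcal{S}(m_i)\ \oplus\ \bigoplus_{i=l+1}^{t}\Big(|\cdot|_{\mathcal{W}_F}^{\alpha_i}\phi_{\delta_i}\otimes\mathcal{S}(m_i)\oplus|\cdot|_{\mathcal{W}_F}^{-\alpha_i}\phi_{\delta_i}\otimes\mathcal{S}(m_i)\Big),$$ where $\mathcal{S}(m_i)$ is a representation of the second factor $\mathrm{SL}(2,\mathbb{C})$ of $\mathcal{L}_F\times\mathrm{SL}(2,\mathbb{C})$. For $X=\mathrm{Sp}_{2n}(F)\backslash\mathrm{GL}_{2n}(F)$ the dual group of $X$ is $\mathrm{GL}(n,\mathbb{C})$ and the distinguished morphism $\varrho:\mathrm{GL}(n,\mathbb{C})\times\mathrm{SL}(2,\mathbb{C})\to\mathrm{GL}(2n,\mathbb{C})$ is the tensor product of the standard representations. Accordingly, $\psi_\pi$ is $X$-distinguished if $\psi_\pi\cong\phi\otimes\mathcal{S}(2)$ for some tempered $L$-parameter $\phi:\mathcal{L}_F\to\mathrm{GL}(n,\mathbb{C})$ (with $\mathcal{S}(2)$ a representation of the second $\mathrm{SL}(2,\mathbb{C})$); an $X$-distinguished $\psi_\pi$ is $X$-elliptic if this holds with $\phi$ elliptic. *)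

theory Defs
  imports
    "HOL-Analysis.Analysis"
    "HOL-Algebra.Algebraic_Closure_Type"
    "Jordan_Normal_Form.Determinant"
begin

text \<open>
  A local field is a type \<open>'f\<close> together with an absolute value \<open>v\<close>. Matrices over \<open>'f\<close> and complex
  matrices of varying size are those of \<open>Jordan_Normal_Form\<close>; elements of \<open>SL(2,\<complex>)\<close> are of type
  \<open>complex^2^2\<close>, which carries a topology.
\<close>

section \<open>Nonarchimedean local fields\<close>

definition residue_card :: "('f::field \<Rightarrow> real) \<Rightarrow> nat" where
  "residue_card v = card ((\<lambda>x. {y. v (y - x) < 1}) ` {x. v x \<le> 1})"

text \<open>The last condition says that \<open>v\<close> is discrete and is the normalized absolute value: a
  uniformizer has absolute value \<open>1/q\<close>.\<close>

definition nonarch_local_field :: "('f::field \<Rightarrow> real) \<Rightarrow> bool" where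
  "nonarch_local_field v \<longleftrightarrow>
     (\<forall>x. 0 \<le> v x) \<and> (\<forall>x. v x = 0 \<longleftrightarrow> x = 0) \<and> (\<forall>x y. v (x * y) = v x * v y) \<and>
     (\<forall>x y. v (x + y) \<le> max (v x) (v y)) \<and>
     (\<forall>s. (\<forall>e>0. \<exists>N. \<forall>i\<ge>N. \<forall>j\<ge>N. v (s i - s j) < e) \<longrightarrow>
        (\<exists>L. (\<lambda>i::nat. v (s i - L)) \<longlonglongrightarrow> 0)) \<and>
     finite ((\<lambda>x. {y. v (y - x) < 1}) ` {x. v x \<le> 1}) \<and>
     v ` (UNIV - {0}) = range (\<lambda>k::int. real (residue_card v) powi k)"

section \<open>The Weil group and L-parameters\<close>

type_synonym 'f weil = "'f alg_closure \<Rightarrow> 'f alg_closure"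
type_synonym 'f langlands = "'f weil \<times> (complex^2^2)"

definition galois_group :: "('f::field) weil set" where
  "galois_group = {w. bij w \<and> (\<forall>x y. w (x + y) = w x + w y) \<and> (\<forall>x y. w (x * y) = w x * w y) \<and>
     (\<forall>a. w (to_ac a) = to_ac a)}"

definition ac_integers :: "('f::field \<Rightarrow> real) \<Rightarrow> 'f alg_closure set" where
  "ac_integers v = {x. \<exists>p. Polynomial.coeff p (Polynomial.degree p) = 1 \<and> (\<forall>i. v (Polynomial.coeff p i) \<le> 1) \<and> poly (map_poly to_ac p) x = 0}"

definition ac_max_ideal :: "('f::field \<Rightarrow> real) \<Rightarrow> 'f alg_closure set" where
  "ac_max_ideal v = {x \<in> ac_integers v. x = 0 \<or> inverse x \<notin> ac_integers v}"

text \<open>\<open>w\<close> acts on the residue field of the algebraic closure as \<open>x \<mapsto> x ^ (q ^ k)\<close>; for negative \<open>k\<close>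
  this is stated for the inverse map.\<close>

definition frob_power :: "('f::field \<Rightarrow> real) \<Rightarrow> 'f weil \<Rightarrow> int \<Rightarrow> bool" where
  "frob_power v w k \<longleftrightarrow> (\<forall>x\<in>ac_integers v.
     if k \<ge> 0 then w x - x ^ (residue_card v ^ nat k) \<in> ac_max_ideal v
     else (w x) ^ (residue_card v ^ nat (- k)) - x \<in> ac_max_ideal v)"

definition weil_group :: "('f::field \<Rightarrow> real) \<Rightarrow> 'f weil set" where
  "weil_group v = {w \<in> galois_group. \<exists>k. frob_power v w k}"

definition inertia_group :: "('f::field \<Rightarrow> real) \<Rightarrow> 'f weil set" where
  "inertia_group v = {w \<in> galois_group. frob_power v w 0}"

text \<open>The topology for which the inertia group, with its Krull topology, is an open subgroup.\<close>

definition weil_topology :: "('f::field \<Rightarrow> real) \<Rightarrow> 'f weil topology" where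
  "weil_topology v = topology_generated_by
     {(\<lambda>u. w \<circ> u) ` {u \<in> inertia_group v. \<forall>x\<in>S. u x = x} | w S. w \<in> weil_group v \<and> finite S}"

text \<open>The Artin map is normalized so that uniformizers correspond to geometric Frobenius elements;
  so \<open>w\<close> acts on the residue field as \<open>x \<mapsto> x\<close> to the power \<open>\<bar>w\<bar>\<close>.\<close>

definition weil_abs :: "('f::field \<Rightarrow> real) \<Rightarrow> 'f weil \<Rightarrow> real" where
  "weil_abs v w = real (residue_card v) powi (THE k. frob_power v w k)"

definition SL2 :: "(complex^2^2) set" where
  "SL2 = {g. Determinants.det g = 1}"

definition langlands_group :: "('f::field \<Rightarrow> real) \<Rightarrow> 'f langlands set" where
  "langlands_group v = weil_group v \<times> SL2"

definition langlands_topology :: "('f::field \<Rightarrow> real) \<Rightarrow> 'f langlands topology" where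
  "langlands_topology v = prod_topology (weil_topology v) (top_of_set SL2)"

definition langlands_mult :: "'f langlands \<Rightarrow> 'f langlands \<Rightarrow> 'f langlands" where
  "langlands_mult x y = (fst x \<circ> fst y, snd x ** snd y)"

definition langlands_inverse :: "'f langlands \<Rightarrow> 'f langlands" where
  "langlands_inverse x = (inv_into UNIV (fst x), matrix_inv (snd x))"

definition GL :: "nat \<Rightarrow> 'a::field mat set" where
  "GL d = {A \<in> carrier_mat d d. Determinant.det A \<noteq> 0}"

text \<open>A regular function on \<open>SL(2)\<close> is the restriction of a polynomial in the four matrix entries.\<close>

definition regular_on_SL2 :: "((complex^2^2) \<Rightarrow> complex) \<Rightarrow> bool" where
  "regular_on_SL2 f \<longleftrightarrow> (\<exists>N (c :: nat \<Rightarrow> nat \<Rightarrow> nat \<Rightarrow> nat \<Rightarrow> complex). \<forall>g\<in>SL2. f g =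
     (\<Sum>i\<le>N. \<Sum>j\<le>N. \<Sum>k\<le>N. \<Sum>l\<le>N. c i j k l *
        vec_nth (vec_nth g 1) 1 ^ i * vec_nth (vec_nth g 1) 2 ^ j *
        vec_nth (vec_nth g 2) 1 ^ k * vec_nth (vec_nth g 2) 2 ^ l))"

definition L_parameter ::
    "('f::field \<Rightarrow> real) \<Rightarrow> nat \<Rightarrow> ('f langlands \<Rightarrow> complex mat) \<Rightarrow> bool" where
  "L_parameter v d \<phi> \<longleftrightarrow>
     (\<forall>x\<in>langlands_group v. \<phi> x \<in> GL d) \<and>
     (\<forall>x\<in>langlands_group v. \<forall>y\<in>langlands_group v. \<phi> (langlands_mult x y) = \<phi> x * \<phi> y) \<and>
     (\<forall>i<d. \<forall>j<d. continuous_map (langlands_topology v) euclidean (\<lambda>x. \<phi> x $$ (i, j))) \<and>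
     (\<forall>i<d. \<forall>j<d. regular_on_SL2 (\<lambda>g. \<phi> (id, g) $$ (i, j))) \<and>
     (\<forall>w\<in>weil_group v. \<exists>D. diagonal_mat D \<and> similar_mat (\<phi> (w, Finite_Cartesian_Product.mat 1)) D)"

definition tempered_parameter ::
    "('f::field \<Rightarrow> real) \<Rightarrow> nat \<Rightarrow> ('f langlands \<Rightarrow> complex mat) \<Rightarrow> bool" where
  "tempered_parameter v d \<phi> \<longleftrightarrow> (\<exists>C. \<forall>w\<in>weil_group v. \<forall>i<d. \<forall>j<d.
     cmod (\<phi> (w, Finite_Cartesian_Product.mat 1) $$ (i, j)) \<le> C)"

definition standard_levi :: "nat list \<Rightarrow> complex mat set" where
  "standard_levi ds = {diag_block_mat As | As. list_all2 (\<lambda>A d. A \<in> GL d) As ds}"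

definition proper_levi :: "nat \<Rightarrow> complex mat set \<Rightarrow> bool" where
  "proper_levi d L \<longleftrightarrow> (\<exists>ds P Q. length ds \<ge> 2 \<and> (\<forall>k\<in>set ds. k \<ge> 1) \<and> sum_list ds = d \<and>
     P \<in> carrier_mat d d \<and> Q \<in> carrier_mat d d \<and> P * Q = 1\<^sub>m d \<and> Q * P = 1\<^sub>m d \<and>
     L = (\<lambda>A. P * A * Q) ` standard_levi ds)"

definition elliptic_parameter ::
    "('f::field \<Rightarrow> real) \<Rightarrow> nat \<Rightarrow> ('f langlands \<Rightarrow> complex mat) \<Rightarrow> bool" where
  "elliptic_parameter v d \<phi> \<longleftrightarrow> \<not> (\<exists>L. proper_levi d L \<and> \<phi> ` langlands_group v \<subseteq> L)"

definition equivalent_on ::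
    "'g set \<Rightarrow> nat \<Rightarrow> ('g \<Rightarrow> complex mat) \<Rightarrow> ('g \<Rightarrow> complex mat) \<Rightarrow> bool" where
  "equivalent_on G d \<phi> \<phi>' \<longleftrightarrow> (\<exists>P Q. \<forall>x\<in>G. \<phi> x \<in> carrier_mat d d \<and> similar_mat_wit (\<phi> x) (\<phi>' x) P Q)"

section \<open>Smooth representations of general linear groups\<close>

text \<open>
  A complex vector space is given as a space of complex-valued functions on a type \<open>'x\<close>; choosing a
  basis realizes every vector space in this way. The tensor product of spaces of functions on \<open>'x\<close>
  and \<open>'y\<close> is then the span of the functions \<open>f x * g y\<close>. Irreducible smooth representations of
  \<open>GL\<^sub>d(F)\<close>, and finite length ones, have countable dimension, so \<open>'x = nat\<close> is large enough for
  each of them.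
\<close>

record ('f, 'x) gl_rep =
  gl_deg :: nat
  gl_space :: "('x \<Rightarrow> complex) set"
  gl_act :: "'f mat \<Rightarrow> ('x \<Rightarrow> complex) \<Rightarrow> ('x \<Rightarrow> complex)"

definition csubspace :: "('x \<Rightarrow> complex) set \<Rightarrow> bool" where
  "csubspace V \<longleftrightarrow> (\<lambda>_. 0) \<in> V \<and> (\<forall>f\<in>V. \<forall>g\<in>V. (\<lambda>x. f x + g x) \<in> V) \<and>
     (\<forall>c. \<forall>f\<in>V. (\<lambda>x. c * f x) \<in> V)"

definition clinear_on :: "('x \<Rightarrow> complex) set \<Rightarrow> (('x \<Rightarrow> complex) \<Rightarrow> ('y \<Rightarrow> complex)) \<Rightarrow> bool" where
  "clinear_on V T \<longleftrightarrow> (\<forall>f\<in>V. \<forall>g\<in>V. T (\<lambda>x. f x + g x) = (\<lambda>y. T f y + T g y)) \<and>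
     (\<forall>c. \<forall>f\<in>V. T (\<lambda>x. c * f x) = (\<lambda>y. c * T f y))"

definition cfunctional_on :: "('x \<Rightarrow> complex) set \<Rightarrow> (('x \<Rightarrow> complex) \<Rightarrow> complex) \<Rightarrow> bool" where
  "cfunctional_on V l \<longleftrightarrow> (\<forall>f\<in>V. \<forall>g\<in>V. l (\<lambda>x. f x + g x) = l f + l g) \<and>
     (\<forall>c. \<forall>f\<in>V. l (\<lambda>x. c * f x) = c * l f)"

definition near :: "('f::field \<Rightarrow> real) \<Rightarrow> nat \<Rightarrow> 'f mat \<Rightarrow> real \<Rightarrow> 'f mat set" where
  "near v d g e = {h \<in> GL d. \<forall>i<d. \<forall>j<d. v (h $$ (i, j) - g $$ (i, j)) < e}"

definition gl_topology :: "('f::field \<Rightarrow> real) \<Rightarrow> nat \<Rightarrow> 'f mat topology" where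
  "gl_topology v d = topology_generated_by {near v d g e | g e. g \<in> GL d \<and> e > 0}"

text \<open>A subgroup is open if and only if it contains some \<open>near v d (1\<^sub>m d) e\<close> with \<open>e > 0\<close>; for
  \<open>e \<le> 1\<close> these sets are themselves compact open subgroups.\<close>

definition smooth_rep :: "('f::field \<Rightarrow> real) \<Rightarrow> ('f, 'x) gl_rep \<Rightarrow> bool" where
  "smooth_rep v \<sigma> \<longleftrightarrow> csubspace (gl_space \<sigma>) \<and>
     (\<forall>g\<in>GL (gl_deg \<sigma>). gl_act \<sigma> g ` gl_space \<sigma> \<subseteq> gl_space \<sigma> \<and> clinear_on (gl_space \<sigma>) (gl_act \<sigma> g)) \<and>
     (\<forall>f\<in>gl_space \<sigma>. gl_act \<sigma> (1\<^sub>m (gl_deg \<sigma>)) f = f) \<and>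
     (\<forall>g\<in>GL (gl_deg \<sigma>). \<forall>h\<in>GL (gl_deg \<sigma>). \<forall>f\<in>gl_space \<sigma>.
        gl_act \<sigma> (g * h) f = gl_act \<sigma> g (gl_act \<sigma> h f)) \<and>
     (\<forall>f\<in>gl_space \<sigma>. \<exists>e>0. \<forall>g\<in>near v (gl_deg \<sigma>) (1\<^sub>m (gl_deg \<sigma>)) e. gl_act \<sigma> g f = f)"

definition admissible_rep :: "('f::field \<Rightarrow> real) \<Rightarrow> ('f, 'x) gl_rep \<Rightarrow> bool" where
  "admissible_rep v \<sigma> \<longleftrightarrow> smooth_rep v \<sigma> \<and>
     (\<forall>e>0. \<exists>B. finite B \<and> (\<forall>f\<in>gl_space \<sigma>.
        (\<forall>g\<in>near v (gl_deg \<sigma>) (1\<^sub>m (gl_deg \<sigma>)) e. gl_act \<sigma> g f = f) \<longrightarrow>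
        (\<exists>c. f = (\<lambda>x. \<Sum>b\<in>B. c b * b x))))"

definition irreducible_rep :: "('f::field \<Rightarrow> real) \<Rightarrow> ('f, 'x) gl_rep \<Rightarrow> bool" where
  "irreducible_rep v \<sigma> \<longleftrightarrow> smooth_rep v \<sigma> \<and> gl_space \<sigma> \<noteq> {\<lambda>_. 0} \<and>
     (\<forall>W\<subseteq>gl_space \<sigma>. csubspace W \<and> (\<forall>g\<in>GL (gl_deg \<sigma>). gl_act \<sigma> g ` W \<subseteq> W) \<longrightarrow>
        W = {\<lambda>_. 0} \<or> W = gl_space \<sigma>)"

definition intertwiner ::
    "('f::field, 'x) gl_rep \<Rightarrow> ('f, 'y) gl_rep \<Rightarrow> (('x \<Rightarrow> complex) \<Rightarrow> ('y \<Rightarrow> complex)) \<Rightarrow> bool" where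
  "intertwiner \<sigma> \<tau> T \<longleftrightarrow> gl_deg \<sigma> = gl_deg \<tau> \<and> T ` gl_space \<sigma> \<subseteq> gl_space \<tau> \<and>
     clinear_on (gl_space \<sigma>) T \<and>
     (\<forall>g\<in>GL (gl_deg \<sigma>). \<forall>f\<in>gl_space \<sigma>. T (gl_act \<sigma> g f) = gl_act \<tau> g (T f))"

definition rep_iso :: "('f::field, 'x) gl_rep \<Rightarrow> ('f, 'y) gl_rep \<Rightarrow> bool" where
  "rep_iso \<sigma> \<tau> \<longleftrightarrow> (\<exists>T. intertwiner \<sigma> \<tau> T \<and> bij_betw T (gl_space \<sigma>) (gl_space \<tau>))"

definition quotient_of :: "('f::field, 'x) gl_rep \<Rightarrow> ('f, 'y) gl_rep \<Rightarrow> bool" where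
  "quotient_of \<sigma> \<tau> \<longleftrightarrow> (\<exists>T. intertwiner \<tau> \<sigma> T \<and> T ` gl_space \<tau> = gl_space \<sigma>)"

text \<open>Unitary means unitarizable: the space of smooth vectors carries an invariant inner product.\<close>

definition irreducible_unitary :: "('f::field \<Rightarrow> real) \<Rightarrow> ('f, 'x) gl_rep \<Rightarrow> bool" where
  "irreducible_unitary v \<sigma> \<longleftrightarrow> irreducible_rep v \<sigma> \<and>
     (\<exists>B :: ('x \<Rightarrow> complex) \<Rightarrow> ('x \<Rightarrow> complex) \<Rightarrow> complex.
        (\<forall>h\<in>gl_space \<sigma>. cfunctional_on (gl_space \<sigma>) (\<lambda>f. B f h)) \<and>
        (\<forall>f\<in>gl_space \<sigma>. \<forall>h\<in>gl_space \<sigma>. B h f = cnj (B f h)) \<and>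
        (\<forall>f\<in>gl_space \<sigma>. f \<noteq> (\<lambda>_. 0) \<longrightarrow> Re (B f f) > 0) \<and>
        (\<forall>g\<in>GL (gl_deg \<sigma>). \<forall>f\<in>gl_space \<sigma>. \<forall>h\<in>gl_space \<sigma>.
           B (gl_act \<sigma> g f) (gl_act \<sigma> g h) = B f h))"

definition Sp :: "nat \<Rightarrow> 'f::field mat set" where
  "Sp n = {g \<in> carrier_mat (2 * n) (2 * n).
     let J = four_block_mat (0\<^sub>m n n) (1\<^sub>m n) (- 1\<^sub>m n) (0\<^sub>m n n) in transpose_mat g * J * g = J}"

definition Sp_distinguished :: "nat \<Rightarrow> ('f::field, 'x) gl_rep \<Rightarrow> bool" where
  "Sp_distinguished n \<sigma> \<longleftrightarrow> (\<exists>l. cfunctional_on (gl_space \<sigma>) l \<and> (\<exists>f\<in>gl_space \<sigma>. l f \<noteq> 0) \<and>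
     (\<forall>h\<in>Sp n. \<forall>f\<in>gl_space \<sigma>. l (gl_act \<sigma> h f) = l f))"

section \<open>Discrete series\<close>

text \<open>\<open>GL\<^sub>d(F)\<close> modulo its centre, as a set of cosets with the quotient topology.\<close>

definition central_coset :: "'f::field mat \<Rightarrow> 'f mat set" where
  "central_coset g = {z \<cdot>\<^sub>m g | z. z \<noteq> 0}"

definition PGL :: "nat \<Rightarrow> 'f::field mat set set" where
  "PGL d = central_coset ` GL d"

definition pgl_topology :: "('f::field \<Rightarrow> real) \<Rightarrow> nat \<Rightarrow> 'f mat set topology" where
  "pgl_topology v d = topology_generated_by {U. U \<subseteq> PGL d \<and> openin (gl_topology v d) (\<Union>U)}"

definition haar_measure_PGL :: "('f::field \<Rightarrow> real) \<Rightarrow> nat \<Rightarrow> 'f mat set measure \<Rightarrow> bool" where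
  "haar_measure_PGL v d M \<longleftrightarrow> space M = PGL d \<and>
     sets M = sigma_sets (PGL d) {U. openin (pgl_topology v d) U} \<and>
     (\<forall>g\<in>GL d. \<forall>A\<in>sets M. emeasure M ((\<lambda>C. (\<lambda>h. g * h) ` C) ` A) = emeasure M A) \<and>
     (\<forall>K. compactin (pgl_topology v d) K \<longrightarrow> emeasure M K < \<infinity>) \<and>
     emeasure M (PGL d) \<noteq> 0"

text \<open>Since the central character is unitary, the absolute value of a matrix coefficient is constant
  on the cosets of the centre, and the choice of the representative of \<open>C\<close> is immaterial.\<close>

definition discrete_series :: "('f::field \<Rightarrow> real) \<Rightarrow> ('f, 'x) gl_rep \<Rightarrow> bool" where
  "discrete_series v \<delta> \<longleftrightarrow> gl_deg \<delta> \<ge> 1 \<and> irreducible_rep v \<delta> \<and> admissible_rep v \<delta> \<and>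
     (\<exists>\<omega>. \<forall>z. z \<noteq> 0 \<longrightarrow> cmod (\<omega> z) = 1 \<and>
        (\<forall>f\<in>gl_space \<delta>. gl_act \<delta> (z \<cdot>\<^sub>m 1\<^sub>m (gl_deg \<delta>)) f = (\<lambda>x. \<omega> z * f x))) \<and>
     (\<exists>M. haar_measure_PGL v (gl_deg \<delta>) M \<and>
        (\<forall>f\<in>gl_space \<delta>. \<forall>l. cfunctional_on (gl_space \<delta>) l \<and>
           (\<exists>e>0. \<forall>g\<in>near v (gl_deg \<delta>) (1\<^sub>m (gl_deg \<delta>)) e. \<forall>h\<in>gl_space \<delta>. l (gl_act \<delta> g h) = l h) \<longrightarrow>
           (\<integral>\<^sup>+C. ennreal ((cmod (l (gl_act \<delta> (SOME g. g \<in> C) f)))\<^sup>2) \<partial>M) < \<infinity>))"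

section \<open>Normalized parabolic induction\<close>

definition block_offset :: "nat list \<Rightarrow> nat \<Rightarrow> nat" where
  "block_offset ds i = sum_list (take i ds)"

definition diag_block :: "nat list \<Rightarrow> 'f mat \<Rightarrow> nat \<Rightarrow> 'f mat" where
  "diag_block ds p i = Matrix.mat (ds ! i) (ds ! i)
     (\<lambda>(a, b). p $$ (block_offset ds i + a, block_offset ds i + b))"

definition parabolic :: "nat list \<Rightarrow> 'f::field mat set" where
  "parabolic ds = {p \<in> GL (sum_list ds). \<forall>i<length ds. \<forall>j<i. \<forall>a<ds ! i. \<forall>b<ds ! j.
     p $$ (block_offset ds i + a, block_offset ds j + b) = 0}"

text \<open>The absolute value of the determinant of the adjoint action on the Lie algebra of the unipotent
  radical, whose \<open>(i,j)\<close> block is multiplied by \<open>p\<^sub>i\<close> on the left and by the inverse of \<open>p\<^sub>j\<close> on the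
  right.\<close>

definition modulus :: "('f::field \<Rightarrow> real) \<Rightarrow> nat list \<Rightarrow> 'f mat \<Rightarrow> real" where
  "modulus v ds p = (\<Prod>i<length ds. \<Prod>j\<in>{i<..<length ds}.
     v (Determinant.det (diag_block ds p i)) ^ (ds ! j) / v (Determinant.det (diag_block ds p j)) ^ (ds ! i))"

definition pure_tensor :: "('x \<Rightarrow> complex) list \<Rightarrow> 'x list \<Rightarrow> complex" where
  "pure_tensor fs xs = (if length xs = length fs then \<Prod>i<length fs. (fs ! i) (xs ! i) else 0)"

text \<open>The graph of the operator by which the tuple \<open>gs\<close> acts on the tensor product of \<open>\<sigma>s\<close>: \<open>t\<close> lies in
  the tensor product and is mapped to \<open>u\<close>.\<close>

definition tensor_act ::
    "('f, 'x) gl_rep list \<Rightarrow> (nat \<Rightarrow> 'f mat) \<Rightarrow> ('x list \<Rightarrow> complex) \<Rightarrow> ('x list \<Rightarrow> complex) \<Rightarrow> bool" where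
  "tensor_act \<sigma>s gs t u \<longleftrightarrow> (\<exists>(N::nat) c fss.
     (\<forall>k<N. list_all2 (\<lambda>\<sigma> f. f \<in> gl_space \<sigma>) \<sigma>s (fss k)) \<and>
     t = (\<lambda>xs. \<Sum>k<N. c k * pure_tensor (fss k) xs) \<and>
     u = (\<lambda>xs. \<Sum>k<N. c k *
        pure_tensor (map (\<lambda>i. gl_act (\<sigma>s ! i) (gs i) (fss k ! i)) [0..<length \<sigma>s]) xs))"

text \<open>\<open>\<sigma>\<^sub>1 \<times> \<dots> \<times> \<sigma>\<^sub>k\<close>: functions on the group with values in the tensor product, written with the
  group element as first argument and extended by zero outside the group.\<close>

definition par_ind ::
    "('f::field \<Rightarrow> real) \<Rightarrow> ('f, 'x) gl_rep list \<Rightarrow> ('f, 'f mat \<times> 'x list) gl_rep" where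
  "par_ind v \<sigma>s = (let ds = map gl_deg \<sigma>s; d = sum_list ds in
     \<lparr> gl_deg = d,
       gl_space = {f.
         (\<forall>g xs. g \<notin> GL d \<longrightarrow> f (g, xs) = 0) \<and>
         (\<forall>p\<in>parabolic ds. \<forall>g\<in>GL d. \<exists>u. tensor_act \<sigma>s (diag_block ds p) (\<lambda>xs. f (g, xs)) u \<and>
            (\<forall>xs. f (p * g, xs) = complex_of_real (sqrt (modulus v ds p)) * u xs)) \<and>
         (\<exists>e>0. \<forall>k\<in>near v d (1\<^sub>m d) e. \<forall>g\<in>GL d. \<forall>xs. f (g * k, xs) = f (g, xs))},
       gl_act = (\<lambda>h f (g, xs). if g \<in> GL d then f (g * h, xs) else 0) \<rparr>)"

definition nu_twist :: "('f::field \<Rightarrow> real) \<Rightarrow> real \<Rightarrow> ('f, 'x) gl_rep \<Rightarrow> ('f, 'x) gl_rep" where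
  "nu_twist v \<alpha> \<sigma> = \<sigma>\<lparr> gl_act := \<lambda>g f x.
     complex_of_real (v (Determinant.det g) powr \<alpha>) * gl_act \<sigma> g f x \<rparr>"

text \<open>\<open>\<sigma>\<close> is (a model of) \<open>\<U>(\<delta>,m)\<close>.\<close>

definition is_U :: "('f::field \<Rightarrow> real) \<Rightarrow> ('f, nat) gl_rep \<Rightarrow> nat \<Rightarrow> ('f, nat) gl_rep \<Rightarrow> bool" where
  "is_U v \<delta> m \<sigma> \<longleftrightarrow>
     (let I = par_ind v (map (\<lambda>i. nu_twist v ((real m - 1) / 2 - real i) \<delta>) [0..<m]) in
        irreducible_rep v \<sigma> \<and> quotient_of \<sigma> I \<and>
        (\<forall>\<tau> :: ('f, nat) gl_rep. irreducible_rep v \<tau> \<and> quotient_of \<tau> I \<longrightarrow> rep_iso \<tau> \<sigma>))"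

section \<open>The local Langlands correspondence\<close>

definition restricted_galois :: "('f::field) alg_closure set \<Rightarrow> 'f weil set" where
  "restricted_galois E = (\<lambda>w. restrict w E) ` galois_group"

definition finite_abelian_extension :: "('f::field) alg_closure set \<Rightarrow> bool" where
  "finite_abelian_extension E \<longleftrightarrow> range to_ac \<subseteq> E \<and>
     (\<forall>x\<in>E. \<forall>y\<in>E. x - y \<in> E \<and> x * y \<in> E \<and> inverse x \<in> E) \<and>
     (\<forall>w\<in>galois_group. w ` E = E) \<and> finite (restricted_galois E) \<and>
     (\<forall>w\<in>galois_group. \<forall>u\<in>galois_group. \<forall>x\<in>E. w (u x) = u (w x))"

text \<open>The Artin map, with values lifted from the abelianized Weil group to the Weil group. It is
  characterized by being a homomorphism to the Galois group of the maximal abelian extension that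
  takes uniformizers to geometric Frobenius elements and kills norms.\<close>

definition artin_map :: "('f::field \<Rightarrow> real) \<Rightarrow> ('f \<Rightarrow> 'f weil) \<Rightarrow> bool" where
  "artin_map v art \<longleftrightarrow>
     (\<forall>a. a \<noteq> 0 \<longrightarrow> art a \<in> weil_group v) \<and>
     (\<forall>a. v a = 1 / real (residue_card v) \<longrightarrow> frob_power v (art a) (- 1)) \<and>
     (\<forall>E. finite_abelian_extension E \<longrightarrow>
        (\<forall>a b. a \<noteq> 0 \<and> b \<noteq> 0 \<longrightarrow> (\<forall>x\<in>E. art (a * b) x = art a (art b x))) \<and>
        (\<forall>a. \<forall>x\<in>E. a \<noteq> 0 \<and> to_ac a = (\<Prod>s\<in>restricted_galois E. s x) \<longrightarrow> (\<forall>y\<in>E. art a y = y)))"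

text \<open>
  \<open>llc\<close> assigns an \<open>L\<close>-parameter to every irreducible admissible representation. Required are: it
  induces bijections from isomorphism classes to equivalence classes; the central character
  corresponds to the determinant (for \<open>d = 1\<close> this is class field theory); compatibility with
  twists by characters and with contragredients; discrete series correspond to the tempered elliptic
  parameters. The compatibility with \<open>L\<close>- and \<open>\<epsilon>\<close>-factors of pairs, which singles out one such
  \<open>llc\<close>, is not imposed: statements about all \<open>llc\<close> with these properties hold in particular for
  the local Langlands correspondence.
\<close>

definition local_langlands ::
    "('f::field \<Rightarrow> real) \<Rightarrow> (('f, nat) gl_rep \<Rightarrow> 'f langlands \<Rightarrow> complex mat) \<Rightarrow> bool" where
  "local_langlands v llc \<longleftrightarrow>
     (let Irr = (\<lambda>d. {\<sigma> :: ('f, nat) gl_rep. gl_deg \<sigma> = d \<and> irreducible_rep v \<sigma> \<and> admissible_rep v \<sigma>});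
          equiv = equivalent_on (langlands_group v) in
      \<exists>art. artin_map v art \<and> (\<forall>d\<ge>1.
        (\<forall>\<sigma>\<in>Irr d. L_parameter v d (llc \<sigma>)) \<and>
        (\<forall>\<sigma>\<in>Irr d. \<forall>\<tau>\<in>Irr d. equiv d (llc \<sigma>) (llc \<tau>) \<longleftrightarrow> rep_iso \<sigma> \<tau>) \<and>
        (\<forall>\<phi>. L_parameter v d \<phi> \<longrightarrow> (\<exists>\<sigma>\<in>Irr d. equiv d \<phi> (llc \<sigma>))) \<and>
        (\<forall>\<sigma>\<in>Irr d. \<forall>a f. a \<noteq> 0 \<and> f \<in> gl_space \<sigma> \<longrightarrow> gl_act \<sigma> (a \<cdot>\<^sub>m 1\<^sub>m d) f =
            (\<lambda>x. Determinant.det (llc \<sigma> (art a, Finite_Cartesian_Product.mat 1)) * f x)) \<and>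
        (\<forall>\<kappa>\<in>Irr 1. \<forall>\<sigma>\<in>Irr d. \<forall>\<tau>\<in>Irr d. \<forall>\<eta>.
            (\<forall>a. a \<noteq> 0 \<longrightarrow> (\<forall>f\<in>gl_space \<kappa>. gl_act \<kappa> (a \<cdot>\<^sub>m 1\<^sub>m 1) f = (\<lambda>x. \<eta> a * f x))) \<and>
            gl_space \<tau> = gl_space \<sigma> \<and>
            (\<forall>g\<in>GL d. \<forall>f\<in>gl_space \<sigma>. gl_act \<tau> g f = (\<lambda>x. \<eta> (Determinant.det g) * gl_act \<sigma> g f x)) \<longrightarrow>
            equiv d (llc \<tau>) (\<lambda>x. (llc \<kappa> x $$ (0, 0)) \<cdot>\<^sub>m llc \<sigma> x)) \<and>
        (\<forall>\<sigma>\<in>Irr d. \<forall>\<tau>\<in>Irr d. \<forall>B :: (nat \<Rightarrow> complex) \<Rightarrow> (nat \<Rightarrow> complex) \<Rightarrow> complex.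
            (\<forall>h\<in>gl_space \<tau>. cfunctional_on (gl_space \<sigma>) (\<lambda>f. B f h)) \<and>
            (\<forall>f\<in>gl_space \<sigma>. cfunctional_on (gl_space \<tau>) (B f)) \<and>
            (\<exists>f\<in>gl_space \<sigma>. \<exists>h\<in>gl_space \<tau>. B f h \<noteq> 0) \<and>
            (\<forall>g\<in>GL d. \<forall>f\<in>gl_space \<sigma>. \<forall>h\<in>gl_space \<tau>. B (gl_act \<sigma> g f) (gl_act \<tau> g h) = B f h) \<longrightarrow>
            equiv d (llc \<tau>) (\<lambda>x. transpose_mat (llc \<sigma> (langlands_inverse x)))) \<and>
        (\<forall>\<sigma>\<in>Irr d. discrete_series v \<sigma> \<longleftrightarrow>
            tempered_parameter v d (llc \<sigma>) \<and> elliptic_parameter v d (llc \<sigma>))))"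

section \<open>Tadic's classification and A-parameters\<close>

text \<open>\<open>us\<close> lists the \<open>(\<delta>\<^sub>i, m\<^sub>i)\<close> of the factors \<open>\<U>(\<delta>\<^sub>i,m\<^sub>i)\<close>, and \<open>cs\<close> the \<open>(\<delta>\<^sub>i, m\<^sub>i, \<alpha>\<^sub>i)\<close> of the factors
  \<open>\<pi>(\<U>(\<delta>\<^sub>i,m\<^sub>i),\<alpha>\<^sub>i)\<close>. The \<open>\<tau>s\<close> are models of the latter on which products can be formed again.\<close>

definition tadic_form ::
    "('f::field \<Rightarrow> real) \<Rightarrow> (('f, nat) gl_rep \<times> nat) list \<Rightarrow> (('f, nat) gl_rep \<times> nat \<times> real) list \<Rightarrow>
     ('f, 'x) gl_rep \<Rightarrow> bool" where
  "tadic_form v us cs \<pi> \<longleftrightarrow> (\<exists>\<sigma>s \<tau>s.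
     list_all2 (\<lambda>(\<delta>, m) \<sigma>. discrete_series v \<delta> \<and> m \<ge> 1 \<and> is_U v \<delta> m \<sigma>) us \<sigma>s \<and>
     list_all2 (\<lambda>(\<delta>, m, \<alpha>) \<tau>. discrete_series v \<delta> \<and> m \<ge> 1 \<and> 0 < \<alpha> \<and> \<alpha> < 1 / 2 \<and> smooth_rep v \<tau> \<and>
        (\<exists>\<sigma>. is_U v \<delta> m \<sigma> \<and> rep_iso \<tau> (par_ind v [nu_twist v \<alpha> \<sigma>, nu_twist v (- \<alpha>) \<sigma>]))) cs \<tau>s \<and>
     rep_iso \<pi> (par_ind v (\<sigma>s @ \<tau>s)))"

text \<open>\<open>\<pi>\<close> has the decomposition \<open>us\<close>, \<open>cs\<close>, uniquely up to permutation of the factors (and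
  isomorphism of the discrete series). By Tadic's theorem the uniqueness holds for every irreducible
  unitary \<open>\<pi>\<close>; it is part of the definition because it is what makes the A-parameter of \<open>\<pi>\<close>
  well defined.\<close>

definition tadic_decomposition ::
    "('f::field \<Rightarrow> real) \<Rightarrow> (('f, nat) gl_rep \<times> nat) list \<Rightarrow> (('f, nat) gl_rep \<times> nat \<times> real) list \<Rightarrow>
     ('f, 'x) gl_rep \<Rightarrow> bool" where
  "tadic_decomposition v us cs \<pi> \<longleftrightarrow> tadic_form v us cs \<pi> \<and>
     (\<forall>us' cs'. tadic_form v us' cs' \<pi> \<longrightarrow> (\<exists>us'' cs''. mset us'' = mset us' \<and> mset cs'' = mset cs' \<and>
        list_all2 (\<lambda>(\<delta>, m) (\<delta>', m'). rep_iso \<delta> \<delta>' \<and> m = m') us us'' \<and>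
        list_all2 (\<lambda>(\<delta>, m, \<alpha>) (\<delta>', m', \<alpha>'). rep_iso \<delta> \<delta>' \<and> m = m' \<and> \<alpha> = \<alpha>') cs cs''))"

text \<open>\<open>\<S>(m)\<close> on homogeneous polynomials of degree \<open>m - 1\<close> in \<open>X, Y\<close>, where a matrix with rows
  \<open>(a,b), (c,d)\<close> sends \<open>X\<close> to \<open>aX + cY\<close> and \<open>Y\<close> to \<open>bX + dY\<close>. Column \<open>s\<close> is the image of
  \<open>X\<^sup>sY\<^sup>m\<^sup>-\<^sup>1\<^sup>-\<^sup>s\<close>, computed with \<open>Y = 1\<close>.\<close>

definition sl2_irrep :: "nat \<Rightarrow> (complex^2^2) \<Rightarrow> complex mat" where
  "sl2_irrep m g = Matrix.mat m m (\<lambda>(r, s).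
     Polynomial.coeff ([: vec_nth (vec_nth g 2) 1, vec_nth (vec_nth g 1) 1 :] ^ s *
                       [: vec_nth (vec_nth g 2) 2, vec_nth (vec_nth g 1) 2 :] ^ (m - 1 - s)) r)"

definition kronecker :: "complex mat \<Rightarrow> complex mat \<Rightarrow> complex mat" where
  "kronecker A B = Matrix.mat (dim_row A * dim_row B) (dim_col A * dim_col B)
     (\<lambda>(i, j). A $$ (i div dim_row B, j div dim_col B) * B $$ (i mod dim_row B, j mod dim_col B))"

definition A_sum ::
    "('f::field \<Rightarrow> real) \<Rightarrow> (('f, nat) gl_rep \<Rightarrow> 'f langlands \<Rightarrow> complex mat) \<Rightarrow>
     (('f, nat) gl_rep \<times> nat) list \<Rightarrow> (('f, nat) gl_rep \<times> nat \<times> real) list \<Rightarrow>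
     'f langlands \<times> (complex^2^2) \<Rightarrow> complex mat" where
  "A_sum v llc us cs = (\<lambda>(x, h). diag_block_mat
     (map (\<lambda>(\<delta>, m). kronecker (llc \<delta> x) (sl2_irrep m h)) us @
      concat (map (\<lambda>(\<delta>, m, \<alpha>).
        [complex_of_real (weil_abs v (fst x) powr \<alpha>) \<cdot>\<^sub>m kronecker (llc \<delta> x) (sl2_irrep m h),
         complex_of_real (weil_abs v (fst x) powr (- \<alpha>)) \<cdot>\<^sub>m kronecker (llc \<delta> x) (sl2_irrep m h)]) cs)))"

definition is_A_parameter ::
    "('f::field \<Rightarrow> real) \<Rightarrow> (('f, nat) gl_rep \<Rightarrow> 'f langlands \<Rightarrow> complex mat) \<Rightarrow> ('f, 'x) gl_rep \<Rightarrow>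
     ('f langlands \<times> (complex^2^2) \<Rightarrow> complex mat) \<Rightarrow> bool" where
  "is_A_parameter v llc \<pi> \<psi> \<longleftrightarrow> (\<exists>us cs. tadic_decomposition v us cs \<pi> \<and>
     equivalent_on (langlands_group v \<times> SL2) (gl_deg \<pi>) \<psi> (A_sum v llc us cs))"

definition X_distinguished ::
    "('f::field \<Rightarrow> real) \<Rightarrow> nat \<Rightarrow> ('f langlands \<times> (complex^2^2) \<Rightarrow> complex mat) \<Rightarrow> bool" where
  "X_distinguished v n \<psi> \<longleftrightarrow> (\<exists>\<phi>. L_parameter v n \<phi> \<and> tempered_parameter v n \<phi> \<and>
     equivalent_on (langlands_group v \<times> SL2) (2 * n) \<psi> (\<lambda>(x, h). kronecker (\<phi> x) (sl2_irrep 2 h)))"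

definition X_elliptic ::
    "('f::field \<Rightarrow> real) \<Rightarrow> nat \<Rightarrow> ('f langlands \<times> (complex^2^2) \<Rightarrow> complex mat) \<Rightarrow> bool" where
  "X_elliptic v n \<psi> \<longleftrightarrow> (\<exists>\<phi>. L_parameter v n \<phi> \<and> tempered_parameter v n \<phi> \<and> elliptic_parameter v n \<phi> \<and>
     equivalent_on (langlands_group v \<times> SL2) (2 * n) \<psi> (\<lambda>(x, h). kronecker (\<phi> x) (sl2_irrep 2 h)))"

end

theory Submission
  imports Defs
begin

text \<open>
  If \<open>\<psi> \<cong> \<phi> \<otimes> \<S>(2)\<close> with \<open>\<phi>\<close> elliptic, compare with the decomposition \<open>\<Oplus> \<rho>\<^sub>i \<otimes> \<S>(m\<^sub>i)\<close> that Tadic's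
  classification attaches to \<open>\<pi>\<close>, the \<open>\<rho>\<^sub>i\<close> being unramified twists of the \<open>\<phi>\<^sub>\<delta>\<close>. The second \<open>SL(2)\<close> acts on the
  left through \<open>\<S>(2)\<close> only, so all \<open>m\<^sub>i\<close> are 2, and passing to an eigenspace of its torus gives
  \<open>\<phi> \<cong> \<Oplus> \<rho>\<^sub>i\<close>. Ellipticity leaves one summand. It is not one of a complementary series, where summands
  come in pairs; hence \<open>\<pi>\<close> is induced from the single representation \<open>\<U>(\<delta>,2)\<close>, that is,
  isomorphic to it. Conversely, uniqueness of the decomposition gives \<open>\<psi> \<cong> \<phi>\<^sub>\<delta> \<otimes> \<S>(2)\<close> for \<open>\<pi> \<cong> \<U>(\<delta>,2)\<close>,
  and \<open>\<phi>\<^sub>\<delta>\<close> is tempered and elliptic because \<open>\<delta>\<close> is a discrete series representation.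
\<close>

section \<open>Isomorphisms and trivial parabolic induction\<close>

lemma rep_iso_trans:
  assumes "rep_iso \<rho> \<sigma>" "rep_iso \<sigma> \<tau>"
  shows "rep_iso \<rho> \<tau>"
proof -
  obtain S T where S: "intertwiner \<rho> \<sigma> S" "bij_betw S (gl_space \<rho>) (gl_space \<sigma>)"
    and T: "intertwiner \<sigma> \<tau> T" "bij_betw T (gl_space \<sigma>) (gl_space \<tau>)"
    using assms unfolding rep_iso_def by blast
  have "S f \<in> gl_space \<sigma>" if "f \<in> gl_space \<rho>" for f
    using S(2) that by (auto simp: bij_betw_def)
  then have "intertwiner \<rho> \<tau> (T \<circ> S)"
    using S(1) T(1) unfolding intertwiner_def clinear_on_def by (auto simp: image_subset_iff)
  then show ?thesis
    using bij_betw_trans[OF S(2) T(2)] unfolding rep_iso_def by blast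
qed

text \<open>The inverse of \<open>T\<close> inherits linearity and equivariance because each
  identity can be tested after applying the injective \<open>T\<close>. Smoothness of
  \<open>\<sigma>\<close> enters through closure of its space under sums, scalars and the action,
  which keeps the tested vectors in the domain of \<open>T\<close>.\<close>

lemma rep_iso_sym:
  assumes "smooth_rep v \<sigma>" "rep_iso \<sigma> \<tau>"
  shows "rep_iso \<tau> \<sigma>"
proof -
  obtain T where T: "intertwiner \<sigma> \<tau> T" and bij: "bij_betw T (gl_space \<sigma>) (gl_space \<tau>)"
    using assms(2) unfolding rep_iso_def by blast
  define S where "S = inv_into (gl_space \<sigma>) T"
  have bijS: "bij_betw S (gl_space \<tau>) (gl_space \<sigma>)"
    unfolding S_def by (rule bij_betw_inv_into[OF bij])
  have mem: "S f \<in> gl_space \<sigma>" if "f \<in> gl_space \<tau>" for f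
    using bijS that by (auto simp: bij_betw_def)
  have TS: "T (S f) = f" if "f \<in> gl_space \<tau>" for f
    using bij that unfolding S_def by (metis bij_betw_inv_into_right)
  have eqI: "S f = h" if "h \<in> gl_space \<sigma>" "T h = f" for f h
    using bij that unfolding S_def by (metis bij_betw_inv_into_left)
  have sub: "csubspace (gl_space \<sigma>)"
    and act: "\<And>g f. g \<in> GL (gl_deg \<sigma>) \<Longrightarrow> f \<in> gl_space \<sigma> \<Longrightarrow> gl_act \<sigma> g f \<in> gl_space \<sigma>"
    using assms(1) unfolding smooth_rep_def by auto
  have "clinear_on (gl_space \<tau>) S"
    unfolding clinear_on_def
  proof (intro conjI ballI allI)
    fix f g assume "f \<in> gl_space \<tau>" "g \<in> gl_space \<tau>"
    then show "S (\<lambda>x. f x + g x) = (\<lambda>y. S f y + S g y)"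
      using sub T mem TS unfolding intertwiner_def clinear_on_def csubspace_def
      by (intro eqI) auto
  next
    fix c f assume "f \<in> gl_space \<tau>"
    then show "S (\<lambda>x. c * f x) = (\<lambda>y. c * S f y)"
      using sub T mem TS unfolding intertwiner_def clinear_on_def csubspace_def
      by (intro eqI) auto
  qed
  moreover have "S (gl_act \<tau> g f) = gl_act \<sigma> g (S f)"
    if "g \<in> GL (gl_deg \<tau>)" "f \<in> gl_space \<tau>" for g f
    using that T mem TS act unfolding intertwiner_def by (intro eqI) auto
  ultimately have "intertwiner \<tau> \<sigma> S"
    using T mem unfolding intertwiner_def by auto
  then show ?thesis
    using bijS unfolding rep_iso_def by blast
qed

lemma pure_tensor_singleton:
  "pure_tensor [h] xs = (if length xs = 1 then h (xs ! 0) else 0)"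
  by (simp add: pure_tensor_def)

text \<open>A tensor product with one factor is that factor, with points replaced by lists of length
  one. A combination of pure tensors therefore collapses to a single one, and linearity of the
  action carries the collapse over to the image.\<close>

lemma tensor_act_singleton:
  assumes sub: "csubspace (gl_space \<sigma>)" and lin: "clinear_on (gl_space \<sigma>) (gl_act \<sigma> (gs 0))"
  shows "tensor_act [\<sigma>] gs t u \<longleftrightarrow>
    (\<exists>h\<in>gl_space \<sigma>. t = pure_tensor [h] \<and> u = pure_tensor [gl_act \<sigma> (gs 0) h])"
proof
  assume "tensor_act [\<sigma>] gs t u"
  then obtain N :: nat and c fss where
    fss: "\<And>k. k < N \<Longrightarrow> list_all2 (\<lambda>\<sigma> f. f \<in> gl_space \<sigma>) [\<sigma>] (fss k)" and
    t: "t = (\<lambda>xs. \<Sum>k<N. c k * pure_tensor (fss k) xs)" and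
    u: "u = (\<lambda>xs. \<Sum>k<N. c k *
        pure_tensor (map (\<lambda>i. gl_act ([\<sigma>] ! i) (gs i) (fss k ! i)) [0..<length [\<sigma>]]) xs)"
    unfolding tensor_act_def by blast
  define h where "h k = hd (fss k)" for k
  have h: "fss k = [h k]" "h k \<in> gl_space \<sigma>" if "k < N" for k
    using fss[OF that] by (auto simp: h_def list_all2_Cons1)
  have zero: "(\<lambda>x. 0) \<in> gl_space \<sigma>" 
    and add: "\<And>f g. f \<in> gl_space \<sigma> \<Longrightarrow> g \<in> gl_space \<sigma> \<Longrightarrow> (\<lambda>x. f x + g x) \<in> gl_space \<sigma>"
    and scale: "\<And>c f. f \<in> gl_space \<sigma> \<Longrightarrow> (\<lambda>x. c * f x) \<in> gl_space \<sigma>"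
    using sub unfolding csubspace_def by auto
  have act_add: "\<And>f g. f \<in> gl_space \<sigma> \<Longrightarrow> g \<in> gl_space \<sigma> \<Longrightarrow>
      gl_act \<sigma> (gs 0) (\<lambda>x. f x + g x) = (\<lambda>y. gl_act \<sigma> (gs 0) f y + gl_act \<sigma> (gs 0) g y)"
    and act_scale: "\<And>c f. f \<in> gl_space \<sigma> \<Longrightarrow>
      gl_act \<sigma> (gs 0) (\<lambda>x. c * f x) = (\<lambda>y. c * gl_act \<sigma> (gs 0) f y)"
    using lin unfolding clinear_on_def by auto
  have act_zero: "gl_act \<sigma> (gs 0) (\<lambda>x. 0) = (\<lambda>y. 0)"
    using act_scale[OF zero, of 0] by simp
  have sums: "(\<lambda>x. \<Sum>k<M. c k * h k x) \<in> gl_space \<sigma> \<and>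
      gl_act \<sigma> (gs 0) (\<lambda>x. \<Sum>k<M. c k * h k x) = (\<lambda>x. \<Sum>k<M. c k * gl_act \<sigma> (gs 0) (h k) x)"
    if "M \<le> N" for M
    using that
  proof (induction M)
    case 0
    then show ?case using zero act_zero by simp
  next
    case (Suc M)
    then show ?case using h[of M] by (simp add: add scale act_add act_scale)
  qed
  define H where "H = (\<lambda>x. \<Sum>k<N. c k * h k x)"
  have "t = pure_tensor [H]"
    unfolding t H_def by (rule ext) (simp add: pure_tensor_singleton h)
  moreover have "u = pure_tensor [gl_act \<sigma> (gs 0) H]"
    unfolding u H_def sums[OF order_refl, THEN conjunct2]
    by (rule ext) (simp add: pure_tensor_singleton h)
  ultimately show "\<exists>h\<in>gl_space \<sigma>. t = pure_tensor [h] \<and> u = pure_tensor [gl_act \<sigma> (gs 0) h]"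
    using sums[OF order_refl] unfolding H_def by blast
next
  assume "\<exists>h\<in>gl_space \<sigma>. t = pure_tensor [h] \<and> u = pure_tensor [gl_act \<sigma> (gs 0) h]"
  then obtain h where "h \<in> gl_space \<sigma>" "t = pure_tensor [h]" "u = pure_tensor [gl_act \<sigma> (gs 0) h]"
    by blast
  then show "tensor_act [\<sigma>] gs t u"
    unfolding tensor_act_def
    by (intro exI[of _ "1::nat"] exI[of _ "\<lambda>_. 1"] exI[of _ "\<lambda>_. [h]"]) auto
qed

lemma parabolic_singleton: "parabolic [d] = GL d"
  by (auto simp: parabolic_def)

lemma modulus_singleton: "modulus v [d] p = 1"
  by (simp add: modulus_def lessThan_Suc)

lemma diag_block_singleton: "p \<in> carrier_mat d d \<Longrightarrow> diag_block [d] p 0 = p"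
  by (auto simp: diag_block_def block_offset_def)

lemma one_in_GL: "1\<^sub>m d \<in> GL d"
  by (simp add: GL_def)

lemma mult_in_GL: "A \<in> GL d \<Longrightarrow> B \<in> GL d \<Longrightarrow> A * B \<in> GL d"
  by (auto simp: GL_def Determinant.det_mult)

text \<open>The parabolic is the whole group and its modulus is trivial, so an induced function is
  determined by its value at the identity. The isomorphism sends \<open>w\<close> to its orbit
  function, whose value at \<open>g\<close> is \<open>g\<close> applied to \<open>w\<close>;
  evaluation at the identity is the inverse.\<close>

lemma rep_iso_par_ind_singleton:
  assumes "smooth_rep v \<sigma>"
  shows "rep_iso \<sigma> (par_ind v [\<sigma>])"
proof -
  define d where "d = gl_deg \<sigma>"
  define V where "V = gl_space \<sigma>"
  define S where "S w = (\<lambda>(g, xs). if g \<in> GL d then pure_tensor [gl_act \<sigma> g w] xs else 0)" for w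
  have sub: "csubspace V"
    and act: "\<And>g f. g \<in> GL d \<Longrightarrow> f \<in> V \<Longrightarrow> gl_act \<sigma> g f \<in> V"
    and lin: "\<And>g. g \<in> GL d \<Longrightarrow> clinear_on V (gl_act \<sigma> g)"
    and act1: "\<And>f. f \<in> V \<Longrightarrow> gl_act \<sigma> (1\<^sub>m d) f = f"
    and act_mult: "\<And>g h f. g \<in> GL d \<Longrightarrow> h \<in> GL d \<Longrightarrow> f \<in> V \<Longrightarrow>
        gl_act \<sigma> (g * h) f = gl_act \<sigma> g (gl_act \<sigma> h f)"
    and smooth: "\<And>f. f \<in> V \<Longrightarrow> \<exists>e>0. \<forall>g\<in>near v d (1\<^sub>m d) e. gl_act \<sigma> g f = f"
    using assms unfolding smooth_rep_def d_def V_def by auto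
  have GLc: "g \<in> carrier_mat d d" if "g \<in> GL d" for g :: "'a mat"
    using that by (simp add: GL_def)
  have tensor: "tensor_act [\<sigma>] (diag_block [d] p) t u \<longleftrightarrow>
      (\<exists>h\<in>V. t = pure_tensor [h] \<and> u = pure_tensor [gl_act \<sigma> p h])" if "p \<in> GL d" for p t u
    using tensor_act_singleton[of \<sigma> "diag_block [d] p" t u] sub lin[OF that]
      diag_block_singleton[OF GLc[OF that]] unfolding V_def by simp
  have space: "gl_space (par_ind v [\<sigma>]) = {f.
         (\<forall>g xs. g \<notin> GL d \<longrightarrow> f (g, xs) = 0) \<and>
         (\<forall>p\<in>GL d. \<forall>g\<in>GL d. \<exists>h\<in>V. (\<lambda>xs. f (g, xs)) = pure_tensor [h] \<and>
            (\<lambda>xs. f (p * g, xs)) = pure_tensor [gl_act \<sigma> p h]) \<and>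
         (\<exists>e>0. \<forall>k\<in>near v d (1\<^sub>m d) e. \<forall>g\<in>GL d. \<forall>xs. f (g * k, xs) = f (g, xs))}"
    (is "_ = ?R")
  proof -
    have *: "(\<exists>u. tensor_act [\<sigma>] (diag_block [d] p) (\<lambda>xs. f (g, xs)) u \<and>
        (\<forall>xs. f (p * g, xs) = complex_of_real (sqrt (modulus v [d] p)) * u xs)) \<longleftrightarrow>
      (\<exists>h\<in>V. (\<lambda>xs. f (g, xs)) = pure_tensor [h] \<and>
            (\<lambda>xs. f (p * g, xs)) = pure_tensor [gl_act \<sigma> p h])" if "p \<in> GL d" for p g f
      unfolding tensor[OF that] modulus_singleton by (auto simp: fun_eq_iff)
    show ?thesis
      unfolding par_ind_def Let_def by (simp add: parabolic_singleton * d_def[symmetric])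
  qed
  have S_mem: "S w \<in> gl_space (par_ind v [\<sigma>])" if w: "w \<in> V" for w
  proof -
    obtain e where e: "e > 0" "\<And>g. g \<in> near v d (1\<^sub>m d) e \<Longrightarrow> gl_act \<sigma> g w = w"
      using smooth[OF w] by blast
    have "S w (g * k, xs) = S w (g, xs)" if "k \<in> near v d (1\<^sub>m d) e" "g \<in> GL d" for k g xs
    proof -
      have "k \<in> GL d" using that(1) by (simp add: near_def)
      then show ?thesis using that e(2)[OF that(1)] w by (simp add: S_def mult_in_GL act_mult)
    qed
    moreover have "\<exists>h\<in>V. (\<lambda>xs. S w (g, xs)) = pure_tensor [h] \<and>
            (\<lambda>xs. S w (p * g, xs)) = pure_tensor [gl_act \<sigma> p h]" if "p \<in> GL d" "g \<in> GL d" for p g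
      by (rule bexI[of _ "gl_act \<sigma> g w"]) (use that w in \<open>auto simp: S_def mult_in_GL act_mult act\<close>)
    moreover have "S w (g, xs) = 0" if "g \<notin> GL d" for g xs
      using that by (simp add: S_def)
    ultimately show ?thesis
      unfolding space using e(1) by blast
  qed
  have S_at_one: "(\<lambda>x. S w (1\<^sub>m d, [x])) = w" if "w \<in> V" for w
    using that by (simp add: S_def one_in_GL act1 pure_tensor_singleton)
  have "f \<in> S ` V" if f: "f \<in> gl_space (par_ind v [\<sigma>])" for f
  proof -
    define w where "w = (\<lambda>x. f (1\<^sub>m d, [x]))"
    \<comment> \<open>Equivariance is applied with \<open>g\<close> as the parabolic element and the
      identity as base point, which expresses \<open>f\<close> at \<open>g\<close> through
      \<open>w\<close>.\<close>
    have key: "w \<in> V \<and> (\<lambda>xs. f (g, xs)) = pure_tensor [gl_act \<sigma> g w]" if g: "g \<in> GL d" for g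
    proof -
      obtain h where h: "h \<in> V" "(\<lambda>xs. f (1\<^sub>m d, xs)) = pure_tensor [h]"
          "(\<lambda>xs. f (g * 1\<^sub>m d, xs)) = pure_tensor [gl_act \<sigma> g h]"
        using f g one_in_GL[of d] unfolding space by blast
      have "w = h"
        unfolding w_def using fun_cong[OF h(2)] by (auto simp: pure_tensor_singleton)
      then show ?thesis using h GLc[OF g] by simp
    qed
    have "f = S w"
    proof (rule ext)
      fix y :: "'a mat \<times> 'b list"
      obtain g xs where "y = (g, xs)" by fastforce
      then show "f y = S w y"
        using f key[of g] unfolding space S_def by (auto simp: fun_eq_iff)
    qed
    then show ?thesis using key[OF one_in_GL] by blast
  qed
  then have "S ` V = gl_space (par_ind v [\<sigma>])"
    using S_mem by blast
  moreover have "inj_on S V"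
    by (rule inj_onI) (metis S_at_one)
  moreover have "clinear_on V S"
    using lin unfolding clinear_on_def S_def by (auto simp: fun_eq_iff pure_tensor_singleton)
  moreover have "S (gl_act \<sigma> g f) = gl_act (par_ind v [\<sigma>]) g (S f)" if "g \<in> GL d" "f \<in> V" for g f
    unfolding par_ind_def Let_def S_def using that d_def
    by (auto simp: fun_eq_iff act_mult mult_in_GL)
  ultimately show ?thesis
    unfolding rep_iso_def intertwiner_def bij_betw_def
    by (intro exI[of _ S]) (auto simp: V_def d_def par_ind_def Let_def)
qed

section \<open>Block matrices, Kronecker products and representations of \<open>SL(2)\<close>\<close>

text \<open>Since the blocks before \<open>A\<close> are square, row and column offsets agree and
  one number locates the block. This serves to read off a diagonal entry of one chosen
  summand.\<close>

lemma diag_block_mat_index: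
  assumes "\<forall>A\<in>set As. square_mat A" "i < dim_row A" "j < dim_col A"
  shows "diag_block_mat (As @ A # Bs) $$ (sum_list (map dim_row As) + i, sum_list (map dim_row As) + j) = A $$ (i, j)"
  using assms(1)
proof (induction As)
  case Nil
  then show ?case using assms by (simp add: Let_def)
next
  case (Cons C As)
  then have sq: "dim_col C = dim_row C" "sum_list (map dim_col As) = sum_list (map dim_row As)"
    by (simp_all cong: map_cong)
  define k where "k = sum_list (map dim_row As)"
  define D where "D = diag_block_mat (As @ A # Bs)"
  have "k + i < dim_row D" "k + j < dim_col D" "D $$ (k + i, k + j) = A $$ (i, j)"
    using Cons assms(2,3) sq unfolding D_def k_def by (simp_all add: dim_diag_block_mat)
  then show ?case
    using sq by (simp add: Let_def add.assoc k_def[symmetric] D_def[symmetric])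
qed

lemma dim_kronecker [simp]:
  "dim_row (kronecker A B) = dim_row A * dim_row B"
  "dim_col (kronecker A B) = dim_col A * dim_col B"
  by (simp_all add: kronecker_def)

text \<open>The identity is literal, not just up to conjugation: the index of the left factor is the
  quotient by the size of \<open>B\<close>, so passing a block of the direct sum shifts indices by a
  whole multiple of that size.\<close>

lemma kronecker_diag_block_mat:
  assumes "dim_row B > 0" "dim_col B > 0"
  shows "diag_block_mat (map (\<lambda>A. kronecker A B) As) = kronecker (diag_block_mat As) B"
proof (induction As)
  case Nil
  show ?case by (auto simp: kronecker_def)
next
  case (Cons A As)
  define D where "D = diag_block_mat As"
  have quot: "(i - a * b) div b = i div b - a" "(i - a * b) mod b = i mod b"
    "i div b < a \<longleftrightarrow> i < a * b" if "b > 0" "\<not> i < a * b" for i a b :: nat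
  proof -
    obtain k where "i = k + a * b" using \<open>\<not> i < a * b\<close> by (metis not_less le_Suc_ex add.commute)
    then show "(i - a * b) div b = i div b - a" "(i - a * b) mod b = i mod b"
      "i div b < a \<longleftrightarrow> i < a * b"
      using \<open>b > 0\<close> by simp_all
  qed
  have "four_block_mat (kronecker A B) (0\<^sub>m (dim_row (kronecker A B)) (dim_col (kronecker D B)))
      (0\<^sub>m (dim_row (kronecker D B)) (dim_col (kronecker A B))) (kronecker D B) =
    kronecker (four_block_mat A (0\<^sub>m (dim_row A) (dim_col D)) (0\<^sub>m (dim_row D) (dim_col A)) D) B"
    (is "?L = ?R")
  proof (rule eq_matI)
    fix i j assume "i < dim_row ?R" "j < dim_col ?R"
    then have ij: "i < (dim_row A + dim_row D) * dim_row B" "j < (dim_col A + dim_col D) * dim_col B"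
      by simp_all
    then have div: "i div dim_row B < dim_row A + dim_row D" "j div dim_col B < dim_col A + dim_col D"
      by (simp_all add: less_mult_imp_div_less)
    have low: "i < dim_row A * dim_row B \<Longrightarrow> i div dim_row B < dim_row A"
      "j < dim_col A * dim_col B \<Longrightarrow> j div dim_col B < dim_col A"
      by (simp_all add: less_mult_imp_div_less)
    note quot' = quot[OF assms(1), of i "dim_row A"] quot[OF assms(2), of j "dim_col A"]
    have "\<not> i < dim_row A * dim_row B \<Longrightarrow> i div dim_row B - dim_row A < dim_row D"
      "\<not> j < dim_col A * dim_col B \<Longrightarrow> j div dim_col B - dim_col A < dim_col D"
      using div quot' assms by linarith+
    then show "?L $$ (i, j) = ?R $$ (i, j)"
      using ij div low assms
      by (cases "i < dim_row A * dim_row B"; cases "j < dim_col A * dim_col B")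
        (simp_all add: kronecker_def quot' add_mult_distrib)
  qed (simp_all add: add_mult_distrib)
  then show ?case
    unfolding list.map diag_block_mat.simps Let_def Cons.IH D_def .
qed

text \<open>Absorbs the unramified twists of complementary series into the left tensor
  factor.\<close>

lemma smult_kronecker: "kronecker (c \<cdot>\<^sub>m A) B = c \<cdot>\<^sub>m kronecker A B"
proof (rule eq_matI)
  fix i j assume "i < dim_row (c \<cdot>\<^sub>m kronecker A B)" "j < dim_col (c \<cdot>\<^sub>m kronecker A B)"
  moreover from this have "i div dim_row B < dim_row A" "j div dim_col B < dim_col A"
    by (simp_all add: less_mult_imp_div_less)
  ultimately show "kronecker (c \<cdot>\<^sub>m A) B $$ (i, j) = (c \<cdot>\<^sub>m kronecker A B) $$ (i, j)"
    by (simp add: kronecker_def)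
qed simp_all

text \<open>The diagonal torus, whose weights distinguish the representations
  \<open>sl2_irrep m\<close>.\<close>

definition sl2_diag :: "complex \<Rightarrow> complex^2^2" where
  "sl2_diag t = (\<chi> i j. if i = j then if i = 1 then t else inverse t else 0)"

lemma sl2_diag_in_SL2: "t \<noteq> 0 \<Longrightarrow> sl2_diag t \<in> SL2"
  by (simp add: SL2_def sl2_diag_def det_2)

lemma sl2_diag_1: "sl2_diag 1 = Finite_Cartesian_Product.mat 1"
  by (simp add: sl2_diag_def Finite_Cartesian_Product.mat_def Finite_Cartesian_Product.vec_eq_iff)

lemma sl2_irrep_carrier: "sl2_irrep m h \<in> carrier_mat m m"
  by (simp add: sl2_irrep_def)

text \<open>The monomials are weight vectors, since the torus scales X by \<open>t\<close> and Y by
  \<open>inverse t\<close>. The highest weight sits at the last index \<open>m - 1\<close>.\<close>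

lemma sl2_irrep_diag: "sl2_irrep m (sl2_diag t) = mat_diag m (\<lambda>s. t ^ s * inverse t ^ (m - 1 - s))"
proof -
  have "Polynomial.coeff ([:0, t:] ^ s * [:inverse t:] ^ k) r =
      (if r = s then t ^ s * inverse t ^ k else 0)" for r s k
  proof -
    have "[:0, t:] = Polynomial.monom t 1" by (simp add: Polynomial.monom_altdef)
    moreover have "[:inverse t:] ^ k = [:inverse t ^ k:]" by (induction k) (simp_all add: mult.commute)
    ultimately have "[:0, t:] ^ s * [:inverse t:] ^ k = Polynomial.smult (inverse t ^ k) (Polynomial.monom (t ^ s) s)"
      by (simp add: Polynomial.monom_power)
    then show ?thesis by simp
  qed
  then show ?thesis
    unfolding sl2_irrep_def sl2_diag_def mat_diag_def by (intro eq_matI) simp_all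
qed

text \<open>In \<open>kronecker A B\<close> with \<open>B\<close> of size 2, the even indices span the copy of the first factor attached
  to the first basis vector of the second.\<close>

definition even_part :: "'a mat \<Rightarrow> 'a mat" where
  "even_part M = Matrix.mat (dim_row M div 2) (dim_col M div 2) (\<lambda>(i, j). M $$ (2 * i, 2 * j))"

lemma even_part_carrier: "M \<in> carrier_mat (2 * n) (2 * n) \<Longrightarrow> even_part M \<in> carrier_mat n n"
  by (simp add: even_part_def)

lemma even_part_kronecker:
  assumes "B \<in> carrier_mat 2 2" "B $$ (0, 0) = 1"
  shows "even_part (kronecker A B) = A"
  using assms by (intro eq_matI) (auto simp: even_part_def kronecker_def)

lemma sum_even_odd:
  fixes f :: "nat \<Rightarrow> 'a::comm_monoid_add"
  shows "(\<Sum>k<2 * n. f k) = (\<Sum>k<n. f (2 * k) + f (2 * k + 1))"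
  by (induction n) (simp_all add: ac_simps)

text \<open>Taking a corner is not multiplicative in general. Here the left factor has no entries
  from even rows to odd columns, so the odd terms of each matrix product sum drop out.\<close>

lemma even_part_mult:
  fixes A B :: "'a::comm_ring_1 mat"
  assumes A: "A \<in> carrier_mat (2 * n) (2 * n)" and B: "B \<in> carrier_mat (2 * n) (2 * n)"
    and zero: "\<And>i j. i < n \<Longrightarrow> j < n \<Longrightarrow> A $$ (2 * i, 2 * j + 1) = 0"
  shows "even_part (A * B) = even_part A * even_part B"
proof (rule eq_matI)
  fix i j assume "i < dim_row (even_part A * even_part B)" "j < dim_col (even_part A * even_part B)"
  then have ij: "i < n" "j < n" using A B by (simp_all add: even_part_def)
  have "even_part (A * B) $$ (i, j) = (\<Sum>k<2 * n. A $$ (2 * i, k) * B $$ (k, 2 * j))"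
    using A B ij by (simp add: even_part_def scalar_prod_def atLeast0LessThan)
  also have "\<dots> = (\<Sum>k<n. A $$ (2 * i, 2 * k) * B $$ (2 * k, 2 * j))"
    using zero[OF ij(1)] by (simp add: sum_even_odd)
  also have "\<dots> = (even_part A * even_part B) $$ (i, j)"
    using A B ij by (simp add: even_part_def scalar_prod_def atLeast0LessThan)
  finally show "even_part (A * B) $$ (i, j) = (even_part A * even_part B) $$ (i, j)" .
qed (use A B in \<open>simp_all add: even_part_def\<close>)

text \<open>The roots of x + 1/x = 5/2 are 2 and 1/2, and a power \<open>2 ^ k\<close> is at least
  1. The passage to the reals makes this comparison available.\<close>

lemma two_powers_sum:
  assumes "(2::complex) ^ k + inverse 2 ^ k = 5 / 2"
  shows "k = 1"
proof -
  define x where "x = (2::real) ^ k"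
  have x: "x > 0" by (simp add: x_def)
  have "complex_of_real (x + inverse x) = complex_of_real (5 / 2)"
    using assms by (simp add: x_def power_one_over inverse_eq_divide)
  then have "x + inverse x = 5 / 2" by (simp only: of_real_eq_iff)
  then have "(x + inverse x) * x = 5 / 2 * x" by (rule arg_cong)
  then have "x * x + 1 = 5 / 2 * x" using x by (simp add: distrib_right)
  then have "(x - 2) * (2 * x - 1) = 0" by (simp add: algebra_simps)
  moreover have "x \<ge> 1" by (simp add: x_def)
  ultimately have "x = 2" by auto
  then have "(2::real) ^ k = 2 ^ 1" by (simp add: x_def)
  then show ?thesis by (subst (asm) power_inject_exp) simp_all
qed

text \<open>Scalar matrices are central, so conjugation fixes them; similarity to a scalar matrix is
  thus an equality.\<close>

lemma similar_mat_wit_smult_one: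
  assumes "similar_mat_wit A ((c::'a::comm_ring_1) \<cdot>\<^sub>m 1\<^sub>m n) P Q"
  shows "A = c \<cdot>\<^sub>m 1\<^sub>m n"
proof -
  have c: "c \<cdot>\<^sub>m 1\<^sub>m n \<in> carrier_mat n n" by simp
  note * = similar_mat_witD2[OF c similar_mat_wit_sym[OF assms]]
  have "A = P * (c \<cdot>\<^sub>m 1\<^sub>m n) * Q" by (rule similar_mat_witD(3)[OF refl assms])
  also have "P * (c \<cdot>\<^sub>m 1\<^sub>m n) = c \<cdot>\<^sub>m P"
    using *(7) by (simp add: mult_smult_distrib[of _ n n _ n])
  also have "\<dots> * Q = c \<cdot>\<^sub>m (P * Q)"
    using *(6,7) by (rule mult_smult_assoc_mat[rotated])
  finally show ?thesis using *(2) by simp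
qed

text \<open>Conjugation by one fixed pair is linear. The common witnesses are essential, as sums of
  similar matrices need not be similar.\<close>

lemma similar_mat_wit_add:
  fixes A :: "'a::comm_ring_1 mat"
  assumes "similar_mat_wit A B P Q" "similar_mat_wit A' B' P Q"
  shows "similar_mat_wit (A + A') (B + B') P Q"
proof -
  note 1 = similar_mat_witD[OF refl assms(1)]
  define n where "n = dim_row A"
  have P: "P \<in> carrier_mat n n" using 1(6) by (simp add: n_def)
  \<comment> \<open>The shared \<open>P\<close> forces both pairs of matrices to have the same
    size.\<close>
  have "dim_row A' = n"
    using similar_mat_witD(6)[OF refl assms(2)] P by auto
  note 2 = similar_mat_witD[OF this[symmetric] assms(2)]
  note 1 = 1[folded n_def]
  have "P * (B + B') = P * B + P * B'"
    using 1(5,6) 2(5) by (intro mult_add_distrib_mat[of _ n n _ n])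
  also have "\<dots> * Q = P * B * Q + P * B' * Q"
    using 1(5-7) 2(5) by (intro add_mult_distrib_mat[of _ n n _ _ n] mult_carrier_mat)
  finally have "A + A' = P * (B + B') * Q"
    using 1(3) 2(3) by simp
  then show ?thesis
    using 1(1,2,4-7) 2(4,5) by (intro similar_mat_witI[where n = n] add_carrier_mat)
qed

lemma sl2_irrep_1: "sl2_irrep m (Finite_Cartesian_Product.mat 1) = 1\<^sub>m m"
  by (simp add: sl2_irrep_diag flip: sl2_diag_1)

lemma kronecker_one: "kronecker (1\<^sub>m n) (1\<^sub>m m) = 1\<^sub>m (n * m)"
proof (rule eq_matI)
  fix i j assume "i < dim_row (1\<^sub>m (n * m) :: complex mat)" "j < dim_col (1\<^sub>m (n * m) :: complex mat)"
  then have ij: "i < n * m" "j < n * m" by simp_all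
  then have m: "m > 0" by (cases m) auto
  have "i = j \<longleftrightarrow> i div m = j div m \<and> i mod m = j mod m" by (metis div_mult_mod_eq)
  then show "kronecker (1\<^sub>m n) (1\<^sub>m m) $$ (i, j) = (1\<^sub>m (n * m) :: complex mat) $$ (i, j)"
    using ij m by (auto simp: kronecker_def less_mult_imp_div_less)
qed simp_all

text \<open>The index modulo 2 selects the basis vector of the second factor. Remainder 0 stands for
  Y, so the even indices carry the lower weight \<open>inverse t\<close>.\<close>

lemma kronecker_one_sl2_diag:
  "kronecker (1\<^sub>m n) (sl2_irrep 2 (sl2_diag t)) = mat_diag (2 * n) (\<lambda>k. if even k then inverse t else t)"
proof (rule eq_matI)
  let ?D = "mat_diag (2 * n) (\<lambda>k. if even k then inverse t else t)"
  fix i j assume "i < dim_row ?D" "j < dim_col ?D"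
  then have ij: "i < 2 * n" "j < 2 * n" by (simp_all add: mat_diag_def)
  show "kronecker (1\<^sub>m n) (sl2_irrep 2 (sl2_diag t)) $$ (i, j) = ?D $$ (i, j)"
    using ij by (cases "even i"; cases "even j"; elim evenE oddE)
      (simp_all add: kronecker_def sl2_irrep_diag mat_diag_def, presburger+)
qed (simp_all add: sl2_irrep_diag mat_diag_def)

text \<open>The relation \<open>g + g\<inverse> = 5/2\<close> for \<open>g = diag(2, 1/2)\<close> is linear, so it survives
  conjugation; on \<open>\<S>(m)\<close> the highest weight vector turns it into \<open>2\<^sup>m\<^sup>-\<^sup>1 + 2\<^sup>1\<^sup>-\<^sup>m = 5/2\<close>.\<close>

lemma sl2_factors_dim_2:
  fixes As :: "(complex mat \<times> nat) list"
  assumes sim: "\<And>h. h \<in> SL2 \<Longrightarrow> similar_mat_wit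
      (diag_block_mat (map (\<lambda>(A, m). kronecker A (sl2_irrep m h)) As))
      (kronecker (1\<^sub>m n) (sl2_irrep 2 h)) P Q"
    and As: "\<And>A m. (A, m) \<in> set As \<Longrightarrow> m \<ge> 1 \<and> square_mat A \<and> dim_row A > 0"
    and mem: "(A, m) \<in> set As"
  shows "m = 2"
proof -
  define D where "D h = diag_block_mat (map (\<lambda>(A, m). kronecker A (sl2_irrep m h)) As)" for h
  have "1 \<cdot>\<^sub>m 1\<^sub>m (2 * n) = (1\<^sub>m (2 * n) :: complex mat)" by auto
  \<comment> \<open>The left factors \<open>A\<close> are not assumed to be identity matrices. This
    equality fixes the total size and later gives \<open>A $$ (0, 0) = 1\<close>.\<close>
  then have D1: "D (sl2_diag 1) = 1 \<cdot>\<^sub>m 1\<^sub>m (2 * n)"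
    using sim[OF sl2_diag_in_SL2[of 1]]
    by (intro similar_mat_wit_smult_one[of _ _ _ P Q]) (simp add: D_def kronecker_one sl2_diag_1 sl2_irrep_1 mult.commute)
  have "mat_diag (2 * n) (\<lambda>k. if even k then inverse 2 else 2) +
      mat_diag (2 * n) (\<lambda>k. if even k then inverse (inverse 2) else inverse 2) =
      (5 / 2 :: complex) \<cdot>\<^sub>m 1\<^sub>m (2 * n)"
    by (intro eq_matI) (auto simp: mat_diag_def)
  moreover have "sl2_diag 2 \<in> SL2" "sl2_diag (inverse 2) \<in> SL2"
    by (simp_all add: sl2_diag_in_SL2)
  then have "similar_mat_wit (D (sl2_diag 2) + D (sl2_diag (inverse 2)))
      (kronecker (1\<^sub>m n) (sl2_irrep 2 (sl2_diag 2)) +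
       kronecker (1\<^sub>m n) (sl2_irrep 2 (sl2_diag (inverse 2)))) P Q"
    unfolding D_def by (intro similar_mat_wit_add sim)
  ultimately have D2: "D (sl2_diag 2) + D (sl2_diag (inverse 2)) = (5 / 2) \<cdot>\<^sub>m 1\<^sub>m (2 * n)"
    by (intro similar_mat_wit_smult_one[of _ _ _ P Q]) (simp only: kronecker_one_sl2_diag)
  obtain Bs Cs where split: "As = Bs @ (A, m) # Cs"
    using split_list[OF mem] by blast
  \<comment> \<open>The position of the first basis vector of \<open>A\<close> tensored with the
    highest weight vector: the offset of the block, then the last index of
    \<open>sl2_irrep m\<close>.\<close>
  define k where "k = sum_list (map (\<lambda>(A, m). dim_row A * m) Bs) + (m - 1)"
  have dim: "dim_row (sl2_irrep m h) = m" "dim_col (sl2_irrep m h) = m" for m h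
    using sl2_irrep_carrier[of m h] by auto
  have m: "m \<ge> 1" and A: "square_mat A" "dim_row A > 0" using As[OF mem] by auto
  have dimD: "dim_row (D h) = (\<Sum>(A, m)\<leftarrow>As. dim_row A * m)"
    "dim_col (D h) = (\<Sum>(A, m)\<leftarrow>As. dim_col A * m)" for h
    by (simp_all add: D_def dim_diag_block_mat comp_def case_prod_unfold dim)
  have lt: "m - 1 < dim_row A * m"
    using m A(2) by (cases "dim_row A") auto
  have kD: "k < dim_row (D h)" for h
    unfolding dimD k_def split using lt by simp
  then have k: "k < 2 * n" using D1 by (metis carrier_matD(1) index_one_mat(2) index_smult_mat(2))
  have entry: "D h $$ (k, k) = A $$ (0, 0) * sl2_irrep m h $$ (m - 1, m - 1)" for h
  proof -
    let ?K = "\<lambda>(A, m). kronecker A (sl2_irrep m h)"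
    have off: "sum_list (map dim_row (map ?K Bs)) = (\<Sum>(A, m)\<leftarrow>Bs. dim_row A * m)"
      by (simp add: case_prod_unfold dim comp_def)
    have sq: "\<forall>C\<in>set (map ?K Bs). square_mat C"
    proof
      fix C assume "C \<in> set (map ?K Bs)"
      then obtain A' m' where C: "C = kronecker A' (sl2_irrep m' h)" and "(A', m') \<in> set Bs" by auto
      then have "(A', m') \<in> set As" by (simp add: split)
      then show "square_mat C" using As by (simp add: C dim square_mat.simps)
    qed
    have "m - 1 < dim_row (kronecker A (sl2_irrep m h))" "m - 1 < dim_col (kronecker A (sl2_irrep m h))"
      using lt A by (simp_all add: dim square_mat.simps)
    from diag_block_mat_index[OF sq this, of "map ?K Cs"]
    have "D h $$ (k, k) = kronecker A (sl2_irrep m h) $$ (m - 1, m - 1)"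
      by (simp only: off D_def split k_def map_append list.map prod.case)
    also have "\<dots> = A $$ (0, 0) * sl2_irrep m h $$ (m - 1, m - 1)"
      using lt A m by (simp add: kronecker_def dim square_mat.simps)
    finally show ?thesis .
  qed
  \<comment> \<open>At the highest weight the power of \<open>inverse t\<close> is trivial. Taking
    \<open>t = 1\<close> normalizes the coefficient to 1, and \<open>t = 2\<close> together with its
    inverse gives the numerical equation for \<open>m - 1\<close>.\<close>
  have "D (sl2_diag t) $$ (k, k) = A $$ (0, 0) * t ^ (m - 1)" for t
    unfolding entry sl2_irrep_diag using m by (simp add: mat_diag_def)
  moreover have "D (sl2_diag 1) $$ (k, k) = 1"
    unfolding D1 using k by simp
  moreover have "D (sl2_diag 2) $$ (k, k) + D (sl2_diag (inverse 2)) $$ (k, k) = 5 / 2"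
  proof -
    have "k < dim_col (D h)" for h
    proof -
      have "dim_col (D h) = dim_row (D h)"
        unfolding dimD by (intro arg_cong[of _ _ sum_list] map_cong)
          (use As in \<open>auto simp: square_mat.simps\<close>)
      then show ?thesis using kD[of h] by simp
    qed
    then show ?thesis
      using arg_cong[OF D2, of "\<lambda>M. M $$ (k, k)"] k kD by simp
  qed
  ultimately have "(2::complex) ^ (m - 1) + inverse 2 ^ (m - 1) = 5 / 2"
    by simp
  then show ?thesis using two_powers_sum[of "m - 1"] by simp
qed

section \<open>Parameters\<close>

text \<open>The identity is the zeroth Frobenius power, since each difference is 0. For 0 to lie in
  the maximal ideal it must be integral, witnessed by the monic polynomial X, whose leading
  coefficient is bounded because \<open>v 1 = 1\<close>.\<close>

lemma id_in_weil_group: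
  assumes "nonarch_local_field v"
  shows "id \<in> weil_group v"
proof -
  have mult: "\<forall>x y. v (x * y) = v x * v y"
    using assms unfolding nonarch_local_field_def by (elim conjE)
  have "\<forall>x. v x = 0 \<longleftrightarrow> x = 0"
    using assms unfolding nonarch_local_field_def by (elim conjE)
  then have v: "v 0 = 0" "v 1 \<noteq> 0" by simp_all
  moreover have "v (1 * 1) = v 1 * v 1" using mult by blast
  ultimately have "v 1 = 1" by simp
  then have "0 \<in> ac_integers v"
    using v unfolding ac_integers_def
    by (intro CollectI exI[of _ "[:0, 1:]"]) (auto simp: Polynomial.coeff_pCons poly_0_coeff_0 coeff_map_poly split: nat.split)
  then have "frob_power v id 0"
    by (simp add: frob_power_def ac_max_ideal_def)
  moreover have "id \<in> galois_group" by (simp add: galois_group_def)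
  ultimately show ?thesis unfolding weil_group_def by blast
qed

lemma mat_1_in_SL2: "Finite_Cartesian_Product.mat 1 \<in> SL2"
  using sl2_diag_in_SL2[of 1] by (simp add: sl2_diag_1)

lemma one_in_langlands_group:
  "nonarch_local_field v \<Longrightarrow> (id, Finite_Cartesian_Product.mat 1) \<in> langlands_group v"
  by (simp add: langlands_group_def id_in_weil_group mat_1_in_SL2)

text \<open>The value at the identity is an invertible idempotent.\<close>

lemma L_parameter_one:
  assumes "nonarch_local_field v" "L_parameter v d \<phi>"
  shows "\<phi> (id, Finite_Cartesian_Product.mat 1) = 1\<^sub>m d"
proof -
  let ?e = "(id, Finite_Cartesian_Product.mat 1) :: 'a langlands"
  have e: "?e \<in> langlands_group v" by (rule one_in_langlands_group[OF assms(1)])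
  have "langlands_mult ?e ?e = ?e" by (simp add: langlands_mult_def)
  then have sq: "\<phi> ?e * \<phi> ?e = \<phi> ?e" and GL: "\<phi> ?e \<in> GL d"
    using assms(2) e unfolding L_parameter_def by metis+
  then have car: "\<phi> ?e \<in> carrier_mat d d" and "Determinant.det (\<phi> ?e) \<noteq> 0"
    by (simp_all add: GL_def)
  then obtain B where B: "B \<in> carrier_mat d d" "B * \<phi> ?e = 1\<^sub>m d"
    using det_non_zero_imp_unit[of "\<phi> ?e" d] by (auto simp: Units_def ring_mat_def)
  have "\<phi> ?e = (B * \<phi> ?e) * \<phi> ?e" using B car by simp
  also have "\<dots> = B * \<phi> ?e" using B(1) car sq by (simp add: assoc_mult_mat[of _ d d _ d _ d])
  finally show ?thesis using B(2) by simp
qed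

lemma weil_abs_pos: "residue_card v > 0 \<Longrightarrow> weil_abs v w > 0"
  by (simp add: weil_abs_def)

lemma smult_in_GL: "c \<noteq> 0 \<Longrightarrow> A \<in> GL d \<Longrightarrow> c \<cdot>\<^sub>m A \<in> GL d"
  by (simp add: GL_def)

text \<open>Conjugation by \<open>P\<close> matches the eigenspaces of \<open>diag(2, 1/2)\<close> on the two sides, and the
  representation of the first factor on one of these eigenspaces recovers it from its tensor product
  with \<open>\<S>(2)\<close>.\<close>

lemma similar_tensor_sl2_cancel:
  assumes A: "A \<in> carrier_mat n n" and B: "B \<in> carrier_mat n n"
    and sim: "similar_mat_wit (kronecker A (sl2_irrep 2 (Finite_Cartesian_Product.mat 1)))
        (kronecker B (sl2_irrep 2 (Finite_Cartesian_Product.mat 1))) P Q"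
    and weight: "similar_mat_wit (kronecker (1\<^sub>m n) (sl2_irrep 2 (sl2_diag 2)))
        (kronecker (1\<^sub>m n) (sl2_irrep 2 (sl2_diag 2))) P Q"
  shows "similar_mat_wit A B (even_part P) (even_part Q)"
proof -
  let ?K = "\<lambda>A. kronecker A (1\<^sub>m 2) :: complex mat"
  define W where "W = mat_diag (2 * n) (\<lambda>k. if even k then inverse 2 else (2::complex))"
  have K: "?K A \<in> carrier_mat (2 * n) (2 * n)" "?K B \<in> carrier_mat (2 * n) (2 * n)"
    using A B by auto
  note wit = similar_mat_witD2[OF K(1) sim[unfolded sl2_irrep_1]]
  note P = wit(6) and Q = wit(7)
  have W: "W \<in> carrier_mat (2 * n) (2 * n)" by (simp add: W_def)
  have "W = P * W * Q"
    using similar_mat_witD(3)[OF refl weight] unfolding kronecker_one_sl2_diag W_def .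
  then have "W * P = P * W * Q * P" by (rule arg_cong)
  also have "\<dots> = P * W * (Q * P)"
    using P Q W by (intro assoc_mult_mat[of _ "2 * n" "2 * n" _ "2 * n" _ "2 * n"] mult_carrier_mat)
  also have "\<dots> = P * W" using wit(2) P W by simp
  finally have PW: "W * P = P * W" .
  \<comment> \<open>Commutation with \<open>W\<close> is compared entrywise: such an entry of
    \<open>P\<close> is multiplied by 1/2 on one side and by 2 on the other, so it vanishes.\<close>
  have zero: "P $$ (2 * i, 2 * j + 1) = 0" if "i < n" "j < n" for i j
    using arg_cong[OF PW, of "\<lambda>M. M $$ (2 * i, 2 * j + 1)"] that
    unfolding W_def mat_diag_mult_left[OF P] mat_diag_mult_right[OF P] by simp
  have zeroK: "?K B $$ (2 * i, 2 * j + 1) = 0" if "i < n" "j < n" for i j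
    using that B by (simp add: kronecker_def)
  have ev: "even_part (?K C) = C" for C
    by (rule even_part_kronecker) auto
  have "even_part P * even_part Q = even_part (P * Q)"
    using even_part_mult[OF P Q zero] by simp
  also have "\<dots> = 1\<^sub>m n"
    using ev[of "1\<^sub>m n"] by (simp add: wit(1) kronecker_one mult.commute)
  finally have inv: "even_part P * even_part Q = 1\<^sub>m n" .
  \<comment> \<open>The product is bracketed so that the left factors are \<open>P\<close> and then
    \<open>?K B\<close>, whose entries from even rows to odd columns are known to vanish.\<close>
  have "A = even_part (P * (?K B * Q))"
    using ev[of A] wit(3) P Q K(2) by (simp add: assoc_mult_mat[of _ "2 * n" "2 * n" _ "2 * n" _ "2 * n"])
  also have "\<dots> = even_part P * even_part (?K B * Q)"
    using K(2) Q zero by (intro even_part_mult[OF P]) auto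
  also have "even_part (?K B * Q) = B * even_part Q"
    using even_part_mult[OF K(2) Q zeroK] by (simp add: ev)
  finally have "A = even_part P * B * even_part Q"
    using even_part_carrier[OF P] even_part_carrier[OF Q] B by simp
  then show ?thesis
    using A B inv even_part_carrier[OF P] even_part_carrier[OF Q]
    by (intro similar_mat_witI[where n = n] mat_mult_left_right_inverse[OF _ _ inv])
qed

text \<open>The summands in uniform shape, with each twist moved into the first component. A
  complementary series factor occupies two entries, so that counting entries can exclude it.\<close>

definition A_factors ::
    "('f::field \<Rightarrow> real) \<Rightarrow> (('f, nat) gl_rep \<Rightarrow> 'f langlands \<Rightarrow> complex mat) \<Rightarrow>
     (('f, nat) gl_rep \<times> nat) list \<Rightarrow> (('f, nat) gl_rep \<times> nat \<times> real) list \<Rightarrow>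
     (('f langlands \<Rightarrow> complex mat) \<times> nat) list" where
  "A_factors v llc us cs = map (\<lambda>(\<delta>, m). (llc \<delta>, m)) us @
     concat (map (\<lambda>(\<delta>, m, \<alpha>).
       [(\<lambda>x. complex_of_real (weil_abs v (fst x) powr \<alpha>) \<cdot>\<^sub>m llc \<delta> x, m),
        (\<lambda>x. complex_of_real (weil_abs v (fst x) powr (- \<alpha>)) \<cdot>\<^sub>m llc \<delta> x, m)]) cs)"

lemma A_sum_eq_A_factors:
  "A_sum v llc us cs (x, h) =
    diag_block_mat (map (\<lambda>(\<rho>, m). kronecker (\<rho> x) (sl2_irrep m h)) (A_factors v llc us cs))"
  by (simp add: A_sum_def A_factors_def map_concat comp_def case_prod_unfold smult_kronecker)

text \<open>Traces a summand back to its representation \<open>\<delta>\<close>. Twisting preserves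
  invertibility because \<open>weil_abs\<close> is a power of the positive residue cardinality, so
  the scalars are nonzero.\<close>

lemma A_factors_GL:
  assumes "residue_card v > 0"
    and us: "\<And>\<delta> m. (\<delta>, m) \<in> set us \<Longrightarrow> L_parameter v (gl_deg \<delta>) (llc \<delta>)"
    and cs: "\<And>\<delta> m \<alpha>. (\<delta>, m, \<alpha>) \<in> set cs \<Longrightarrow> L_parameter v (gl_deg \<delta>) (llc \<delta>)"
    and mem: "(\<rho>, m) \<in> set (A_factors v llc us cs)"
  obtains \<delta> where "(\<delta>, m) \<in> set us \<or> (\<exists>\<alpha>. (\<delta>, m, \<alpha>) \<in> set cs)"
    "\<And>x. x \<in> langlands_group v \<Longrightarrow> \<rho> x \<in> GL (gl_deg \<delta>)"
proof -
  have GL: "llc \<delta> x \<in> GL (gl_deg \<delta>)"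
    if "L_parameter v (gl_deg \<delta>) (llc \<delta>)" "x \<in> langlands_group v" for \<delta> x
    using that unfolding L_parameter_def by blast
  have nz: "complex_of_real (weil_abs v w powr \<alpha>) \<noteq> 0" for w \<alpha>
    using weil_abs_pos[OF assms(1), of w] by simp
  from mem consider \<delta> where "(\<delta>, m) \<in> set us" "\<rho> = llc \<delta>"
    | \<delta> \<alpha> \<beta> where "(\<delta>, m, \<alpha>) \<in> set cs"
      "\<rho> = (\<lambda>x. complex_of_real (weil_abs v (fst x) powr \<beta>) \<cdot>\<^sub>m llc \<delta> x)"
    unfolding A_factors_def by auto
  then show ?thesis
  proof cases
    case 1
    then show ?thesis using GL[OF us] by (intro that[of \<delta>]) blast+
  next
    case 2
    then show ?thesis using GL[OF cs] smult_in_GL[OF nz] by (intro that[of \<delta>]) blast+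
  qed
qed

text \<open>The witnesses \<open>P\<close> and \<open>Q\<close> depend on neither \<open>x\<close>
  nor \<open>h\<close>. Hence the torus condition found at the identity of the first group applies
  to the same matrices that relate the values at every \<open>x\<close>, and a single Levi subgroup
  receives the whole image of \<open>\<phi>\<close>.\<close>

lemma elliptic_tensor_sl2_single_factor:
  fixes fs :: "(('f::field langlands \<Rightarrow> complex mat) \<times> nat) list"
  assumes loc: "nonarch_local_field v" and n: "n \<ge> 1"
    and \<phi>: "L_parameter v n \<phi>" and ell: "elliptic_parameter v n \<phi>"
    and fs: "\<And>\<rho> m. (\<rho>, m) \<in> set fs \<Longrightarrow> m \<ge> 1 \<and> (\<exists>d\<ge>1. \<forall>x\<in>langlands_group v. \<rho> x \<in> GL d)"
    and sim: "\<And>x h. x \<in> langlands_group v \<Longrightarrow> h \<in> SL2 \<Longrightarrow> similar_mat_wit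
      (diag_block_mat (map (\<lambda>(\<rho>, m). kronecker (\<rho> x) (sl2_irrep m h)) fs))
      (kronecker (\<phi> x) (sl2_irrep 2 h)) P Q"
  shows "\<exists>\<rho>. fs = [(\<rho>, 2)]"
proof -
  let ?e = "(id, Finite_Cartesian_Product.mat 1) :: 'f langlands"
  note e = one_in_langlands_group[OF loc] and \<phi>e = L_parameter_one[OF loc \<phi>]
  have SL2: "sl2_diag 2 \<in> SL2" by (simp add: sl2_diag_in_SL2)
  \<comment> \<open>Restriction to the second \<open>SL(2)\<close>, where \<open>\<phi>\<close>
    contributes an identity matrix.\<close>
  have "m = 2" if mem: "(\<rho>, m) \<in> set fs" for \<rho> m
  proof (rule sl2_factors_dim_2[of "map (\<lambda>(\<rho>, m). (\<rho> ?e, m)) fs" n P Q "\<rho> ?e"])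
    show "similar_mat_wit
        (diag_block_mat (map (\<lambda>(A, m). kronecker A (sl2_irrep m h)) (map (\<lambda>(\<rho>, m). (\<rho> ?e, m)) fs)))
        (kronecker (1\<^sub>m n) (sl2_irrep 2 h)) P Q" if "h \<in> SL2" for h
      using sim[OF e that] by (simp add: \<phi>e comp_def case_prod_unfold)
    show "(\<rho> ?e, m) \<in> set (map (\<lambda>(\<rho>, m). (\<rho> ?e, m)) fs)"
      using mem by force
    show "m' \<ge> 1 \<and> square_mat A \<and> dim_row A > 0"
      if A: "(A, m') \<in> set (map (\<lambda>(\<rho>, m). (\<rho> ?e, m)) fs)" for A m'
    proof -
      obtain \<rho>' where "(\<rho>', m') \<in> set fs" "A = \<rho>' ?e" using A by auto
      then show ?thesis using fs[of \<rho>' m'] e by (fastforce simp: GL_def square_mat.simps)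
    qed
  qed
  then have fs_eq: "fs = map (\<lambda>\<rho>. (\<rho>, 2)) (map fst fs)"
    by (simp add: comp_def) (rule map_idI[symmetric], auto)
  define \<rho>s where "\<rho>s = map fst fs"
  define \<Phi> where "\<Phi> x = diag_block_mat (map (\<lambda>\<rho>. \<rho> x) \<rho>s)" for x
  have "\<exists>d. \<forall>\<rho>\<in>set \<rho>s. d \<rho> \<ge> 1 \<and> (\<forall>x\<in>langlands_group v. \<rho> x \<in> GL (d \<rho>))"
    using fs unfolding \<rho>s_def by (intro bchoice) fastforce
  then obtain d where d: "\<And>\<rho>. \<rho> \<in> set \<rho>s \<Longrightarrow> d \<rho> \<ge> 1"
    "\<And>\<rho> x. \<rho> \<in> set \<rho>s \<Longrightarrow> x \<in> langlands_group v \<Longrightarrow> \<rho> x \<in> GL (d \<rho>)"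
    by blast
  have sum_\<Phi>: "diag_block_mat (map (\<lambda>(\<rho>, m). kronecker (\<rho> x) (sl2_irrep m h)) fs) =
      kronecker (\<Phi> x) (sl2_irrep 2 h)" for x h
    unfolding \<Phi>_def fs_eq[folded \<rho>s_def]
    using kronecker_diag_block_mat[of "sl2_irrep 2 h" "map (\<lambda>\<rho>. \<rho> x) \<rho>s"] sl2_irrep_carrier[of 2 h]
    by (simp add: comp_def)
  note sim = sim[unfolded sum_\<Phi>]
  have dims: "dim_row (\<Phi> x) = sum_list (map d \<rho>s)" "dim_col (\<Phi> x) = sum_list (map d \<rho>s)"
    if "x \<in> langlands_group v" for x
  proof -
    have "dim_row (\<rho> x) = d \<rho> \<and> dim_col (\<rho> x) = d \<rho>" if "\<rho> \<in> set \<rho>s" for \<rho>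
      using d(2)[OF that \<open>x \<in> langlands_group v\<close>] by (auto simp: GL_def)
    then show "dim_row (\<Phi> x) = sum_list (map d \<rho>s)" "dim_col (\<Phi> x) = sum_list (map d \<rho>s)"
      by (simp_all add: \<Phi>_def dim_diag_block_mat comp_def cong: map_cong)
  qed
  have \<phi>c: "\<phi> x \<in> carrier_mat n n" if "x \<in> langlands_group v" for x
    using \<phi> that unfolding L_parameter_def GL_def by blast
  have "dim_row (kronecker (\<Phi> ?e) (sl2_irrep 2 (sl2_diag 2))) =
      dim_row (kronecker (\<phi> ?e) (sl2_irrep 2 (sl2_diag 2)))"
    using similar_mat_witD(4,5)[OF refl sim[OF e SL2]] by (metis carrier_matD(1))
  then have sum_d: "sum_list (map d \<rho>s) = n"
    using sl2_irrep_carrier[of 2 "sl2_diag 2"] \<phi>e dims[OF e] by simp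
  have \<Phi>c: "\<Phi> x \<in> carrier_mat n n" if "x \<in> langlands_group v" for x
    using dims[OF that] sum_d by auto
  \<comment> \<open>The entries of \<open>fs\<close> are not assumed to be homomorphisms, so this
    value is obtained from that of \<open>\<phi>\<close> by conjugating a scalar matrix.\<close>
  have "\<Phi> ?e = 1\<^sub>m n"
  proof -
    have "kronecker (\<Phi> ?e) (1\<^sub>m 2) = 1 \<cdot>\<^sub>m 1\<^sub>m (2 * n)"
    proof (rule similar_mat_wit_smult_one)
      have "1 \<cdot>\<^sub>m 1\<^sub>m (2 * n) = (1\<^sub>m (2 * n) :: complex mat)" by auto
      then show "similar_mat_wit (kronecker (\<Phi> ?e) (1\<^sub>m 2)) (1 \<cdot>\<^sub>m 1\<^sub>m (2 * n)) P Q"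
        using sim[OF e mat_1_in_SL2] by (simp add: \<phi>e sl2_irrep_1 kronecker_one mult.commute)
    qed
    also have "\<dots> = kronecker (1\<^sub>m n) (1\<^sub>m 2)" by (simp add: kronecker_one mult.commute) auto
    finally have "even_part (kronecker (\<Phi> ?e) (1\<^sub>m 2)) = even_part (kronecker (1\<^sub>m n) (1\<^sub>m 2))" by simp
    then show ?thesis by (simp add: even_part_kronecker)
  qed
  then have weight: "similar_mat_wit (kronecker (1\<^sub>m n) (sl2_irrep 2 (sl2_diag 2)))
      (kronecker (1\<^sub>m n) (sl2_irrep 2 (sl2_diag 2))) P Q"
    using sim[OF e SL2] by (simp add: \<phi>e)
  define P' where "P' = even_part P"
  define Q' where "Q' = even_part Q"
  have sim': "similar_mat_wit (\<phi> x) (\<Phi> x) Q' P'" if "x \<in> langlands_group v" for x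
    unfolding P'_def Q'_def
    by (rule similar_mat_wit_sym)
      (rule similar_tensor_sl2_cancel[OF \<Phi>c[OF that] \<phi>c[OF that] sim[OF that mat_1_in_SL2] weight])
  have "\<not> length \<rho>s \<ge> 2"
  proof
    assume len: "length \<rho>s \<ge> 2"
    define L where "L = (\<lambda>A. Q' * A * P') ` standard_levi (map d \<rho>s)"
    note wit = similar_mat_witD2[OF \<phi>c[OF e] sim'[OF e]]
    have "proper_levi n L"
      unfolding proper_levi_def
      by (intro exI[of _ "map d \<rho>s"] exI[of _ Q'] exI[of _ P'])
        (use len d(1) sum_d wit(1,2,6,7) in \<open>auto simp: L_def\<close>)
    moreover have "\<phi> ` langlands_group v \<subseteq> L"
    proof
      fix M assume "M \<in> \<phi> ` langlands_group v"
      then obtain x where x: "x \<in> langlands_group v" "M = \<phi> x" by blast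
      have "list_all2 (\<lambda>A d. A \<in> GL d) (map (\<lambda>\<rho>. \<rho> x) \<rho>s) (map d \<rho>s)"
        using d(2) x(1) by (auto simp: list_all2_conv_all_nth)
      then have "\<Phi> x \<in> standard_levi (map d \<rho>s)"
        unfolding standard_levi_def \<Phi>_def by blast
      moreover have "M = Q' * \<Phi> x * P'"
        unfolding x(2) by (rule similar_mat_witD(3)[OF refl sim'[OF x(1)]])
      ultimately show "M \<in> L" unfolding L_def by blast
    qed
    ultimately show False using ell unfolding elliptic_parameter_def by blast
  qed
  \<comment> \<open>An empty direct sum would have size 0.\<close>
  moreover have "\<rho>s \<noteq> []" using sum_d n by auto
  ultimately obtain \<rho> where "\<rho>s = [\<rho>]"
    by (cases \<rho>s; cases "tl \<rho>s") auto
  then show ?thesis using fs_eq[folded \<rho>s_def] by simp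
qed

text \<open>Complementary series factors contribute their summands in pairs, so a single summand can
  only come from \<open>us\<close>.\<close>

lemma A_factors_singleton:
  assumes "A_factors v llc us cs = [(\<rho>, m)]"
  obtains \<delta> where "us = [(\<delta>, m)]" "cs = []" "\<rho> = llc \<delta>"
proof -
  have "cs = []"
  proof (cases cs)
    case (Cons c cs')
    then show ?thesis using assms by (cases us) (auto simp: A_factors_def case_prod_unfold)
  qed
  then show ?thesis using assms that by (auto simp: A_factors_def case_prod_unfold)
qed

text \<open>Eliminates \<open>\<psi>\<close> while keeping one pair of witnesses for all of
  \<open>G\<close>.\<close>

lemma equivalent_on_common:
  assumes "equivalent_on G d \<psi> \<alpha>" "equivalent_on G d \<psi> \<beta>"
  obtains P Q where "\<And>x. x \<in> G \<Longrightarrow> similar_mat_wit (\<alpha> x) (\<beta> x) P Q"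
proof -
  obtain P Q P' Q' where
    "\<And>x. x \<in> G \<Longrightarrow> similar_mat_wit (\<psi> x) (\<alpha> x) P Q" "\<And>x. x \<in> G \<Longrightarrow> similar_mat_wit (\<psi> x) (\<beta> x) P' Q'"
    using assms unfolding equivalent_on_def by blast
  then have "similar_mat_wit (\<alpha> x) (\<beta> x) (Q * P') (Q' * P)" if "x \<in> G" for x
    using that by (intro similar_mat_wit_trans[OF similar_mat_wit_sym])
  then show ?thesis by (rule that)
qed

lemma local_langlands_discrete_series:
  assumes "local_langlands v llc" "discrete_series v \<delta>"
  shows "L_parameter v (gl_deg \<delta>) (llc \<delta>)" "tempered_parameter v (gl_deg \<delta>) (llc \<delta>)"
    "elliptic_parameter v (gl_deg \<delta>) (llc \<delta>)"
proof -
  define Irr where "Irr d = {\<sigma> :: ('a, nat) gl_rep. gl_deg \<sigma> = d \<and> irreducible_rep v \<sigma> \<and> admissible_rep v \<sigma>}" for d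
  have "\<forall>\<sigma>\<in>Irr d. L_parameter v d (llc \<sigma>)"
    "\<forall>\<sigma>\<in>Irr d. discrete_series v \<sigma> \<longleftrightarrow> tempered_parameter v d (llc \<sigma>) \<and> elliptic_parameter v d (llc \<sigma>)"
    if "d \<ge> 1" for d
    using assms(1) that unfolding local_langlands_def Let_def Irr_def by meson+
  moreover have "gl_deg \<delta> \<ge> 1" "\<delta> \<in> Irr (gl_deg \<delta>)"
    using assms(2) unfolding discrete_series_def Irr_def by simp_all
  ultimately show "L_parameter v (gl_deg \<delta>) (llc \<delta>)" "tempered_parameter v (gl_deg \<delta>) (llc \<delta>)"
    "elliptic_parameter v (gl_deg \<delta>) (llc \<delta>)"
    using assms(2) by blast+
qed

lemma list_all2_memD: "list_all2 R xs ys \<Longrightarrow> x \<in> set xs \<Longrightarrow> \<exists>y. R x y"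
  by (metis in_set_conv_nth list_all2_conv_all_nth)

lemma tadic_form_discrete_series:
  fixes v :: "'f::field \<Rightarrow> real"
  assumes "tadic_form v us cs \<pi>" "(\<delta>, m) \<in> set us \<or> (\<exists>\<alpha>. (\<delta>, m, \<alpha>) \<in> set cs)"
  shows "discrete_series v \<delta> \<and> m \<ge> 1"
proof -
  obtain \<sigma>s and \<tau>s :: "('f, nat) gl_rep list" where
    us: "list_all2 (\<lambda>(\<delta>, m) \<sigma>. discrete_series v \<delta> \<and> m \<ge> 1 \<and> is_U v \<delta> m \<sigma>) us \<sigma>s" and
    cs: "list_all2 (\<lambda>(\<delta>, m, \<alpha>) \<tau>. discrete_series v \<delta> \<and> m \<ge> 1 \<and> 0 < \<alpha> \<and> \<alpha> < 1 / 2 \<and> smooth_rep v \<tau> \<and>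
        (\<exists>\<sigma>. is_U v \<delta> m \<sigma> \<and> rep_iso \<tau> (par_ind v [nu_twist v \<alpha> \<sigma>, nu_twist v (- \<alpha>) \<sigma>]))) cs \<tau>s"
    using assms(1) unfolding tadic_form_def by (elim exE conjE) (rule that)
  from assms(2) show ?thesis
  proof
    assume "(\<delta>, m) \<in> set us"
    from list_all2_memD[OF us this] show ?thesis by auto
  next
    assume "\<exists>\<alpha>. (\<delta>, m, \<alpha>) \<in> set cs"
    then obtain \<alpha> where "(\<delta>, m, \<alpha>) \<in> set cs" ..
    from list_all2_memD[OF cs this] show ?thesis by auto
  qed
qed

text \<open>Intertwiners preserve the degree, and the induced representation is built from
  \<open>m\<close> twists of \<open>\<delta>\<close>.\<close>

lemma gl_deg_is_U: "is_U v \<delta> m \<sigma> \<Longrightarrow> gl_deg \<sigma> = m * gl_deg \<delta>"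
  unfolding is_U_def quotient_of_def intertwiner_def Let_def
  by (auto simp: par_ind_def Let_def nu_twist_def comp_def sum_list_triv)

theorem proposition4p5:
  fixes v :: "'f::field_char_0 \<Rightarrow> real"
    and n :: nat
    and llc :: "('f, nat) gl_rep \<Rightarrow> 'f langlands \<Rightarrow> complex mat"
    and \<pi> :: "('f, 'x) gl_rep"
    and \<psi> :: "'f langlands \<times> (complex^2^2) \<Rightarrow> complex mat"
  assumes "nonarch_local_field v"
    and "odd (residue_card v)"
    and "n \<ge> 2"
    and "local_langlands v llc"
    and "gl_deg \<pi> = 2 * n"
    and "irreducible_unitary v \<pi>"
    and "Sp_distinguished n \<pi>"
    and "is_A_parameter v llc \<pi> \<psi>"
  shows "X_distinguished v n \<psi> \<and> X_elliptic v n \<psi> \<longleftrightarrow>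
    (\<exists>\<delta> \<sigma>. discrete_series v \<delta> \<and> gl_deg \<delta> = n \<and> is_U v \<delta> 2 \<sigma> \<and> rep_iso \<pi> \<sigma>)"
proof -
  obtain us cs where dec: "tadic_decomposition v us cs \<pi>"
    and \<psi>: "equivalent_on (langlands_group v \<times> SL2) (2 * n) \<psi> (A_sum v llc us cs)"
    using assms(5,8) unfolding is_A_parameter_def by auto
  have form: "tadic_form v us cs \<pi>" using dec unfolding tadic_decomposition_def by blast
  note ds = tadic_form_discrete_series[OF form]
  note llc = local_langlands_discrete_series[OF assms(4)]
  have smooth: "smooth_rep v \<sigma>" if "is_U v \<delta> m \<sigma>" for \<delta> m \<sigma>
    using that unfolding is_U_def irreducible_rep_def Let_def by blast
  show ?thesis
  proof
    assume "X_distinguished v n \<psi> \<and> X_elliptic v n \<psi>"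
    then obtain \<phi> where \<phi>: "L_parameter v n \<phi>" "elliptic_parameter v n \<phi>"
      and \<psi>': "equivalent_on (langlands_group v \<times> SL2) (2 * n) \<psi> (\<lambda>(x, h). kronecker (\<phi> x) (sl2_irrep 2 h))"
      unfolding X_elliptic_def by blast
    obtain P Q where wit: "\<And>y. y \<in> langlands_group v \<times> SL2 \<Longrightarrow>
        similar_mat_wit (A_sum v llc us cs y) ((\<lambda>(x, h). kronecker (\<phi> x) (sl2_irrep 2 h)) y) P Q"
      using equivalent_on_common[OF \<psi> \<psi>'] by blast
    have "\<exists>\<rho>. A_factors v llc us cs = [(\<rho>, 2)]"
    proof (rule elliptic_tensor_sl2_single_factor[OF assms(1) _ \<phi>])
      show "1 \<le> n" using assms(3) by simp
      show "similar_mat_wit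
          (diag_block_mat (map (\<lambda>(\<rho>, m). kronecker (\<rho> x) (sl2_irrep m h)) (A_factors v llc us cs)))
          (kronecker (\<phi> x) (sl2_irrep 2 h)) P Q" if "x \<in> langlands_group v" "h \<in> SL2" for x h
        using wit[of "(x, h)"] that by (simp add: A_sum_eq_A_factors)
      show "1 \<le> m \<and> (\<exists>d\<ge>1. \<forall>x\<in>langlands_group v. \<rho> x \<in> GL d)"
        if mem: "(\<rho>, m) \<in> set (A_factors v llc us cs)" for \<rho> m
      proof -
        \<comment> \<open>Positivity makes the twisting scalars nonzero.\<close>
        have "residue_card v > 0" using assms(2) by (rule odd_pos)
        moreover have "L_parameter v (gl_deg \<delta>) (llc \<delta>)"
          if "(\<delta>, m) \<in> set us \<or> (\<exists>\<alpha>. (\<delta>, m, \<alpha>) \<in> set cs)" for \<delta> m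
          using ds[OF that] llc(1) by blast
        ultimately obtain \<delta> where \<delta>: "(\<delta>, m) \<in> set us \<or> (\<exists>\<alpha>. (\<delta>, m, \<alpha>) \<in> set cs)"
          "\<And>x. x \<in> langlands_group v \<Longrightarrow> \<rho> x \<in> GL (gl_deg \<delta>)"
          using A_factors_GL[of v us llc cs \<rho> m] mem by metis
        have "m \<ge> 1" "discrete_series v \<delta>" using ds[OF \<delta>(1)] by blast+
        moreover from this(2) have "gl_deg \<delta> \<ge> 1" unfolding discrete_series_def by (elim conjE)
        ultimately show ?thesis using \<delta>(2) by blast
      qed
    qed
    then obtain \<delta> where us: "us = [(\<delta>, 2)]" and cs: "cs = []"
      by (elim exE A_factors_singleton)
    obtain \<sigma> where \<sigma>: "discrete_series v \<delta>" "is_U v \<delta> 2 \<sigma>" "rep_iso \<pi> (par_ind v [\<sigma>])"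
      using form unfolding tadic_form_def us cs by (auto simp: list_all2_Cons1)
    \<comment> \<open>With one factor left, the induction is from the whole group and changes
      nothing up to isomorphism.\<close>
    have "rep_iso \<pi> \<sigma>"
      using rep_iso_trans[OF \<sigma>(3) rep_iso_sym[OF smooth rep_iso_par_ind_singleton[OF smooth]]] \<sigma>(2)
      by blast
    moreover from this have "gl_deg \<delta> = n"
      using gl_deg_is_U[OF \<sigma>(2)] assms(5) unfolding rep_iso_def intertwiner_def by auto
    ultimately show "\<exists>\<delta> \<sigma>. discrete_series v \<delta> \<and> gl_deg \<delta> = n \<and> is_U v \<delta> 2 \<sigma> \<and> rep_iso \<pi> \<sigma>"
      using \<sigma> by blast
  next
    assume "\<exists>\<delta> \<sigma>. discrete_series v \<delta> \<and> gl_deg \<delta> = n \<and> is_U v \<delta> 2 \<sigma> \<and> rep_iso \<pi> \<sigma>"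
    then obtain \<delta> \<sigma> where \<delta>: "discrete_series v \<delta>" "gl_deg \<delta> = n" "is_U v \<delta> 2 \<sigma>" "rep_iso \<pi> \<sigma>"
      by blast
    \<comment> \<open>The Speh representation is its own decomposition. Uniqueness then determines
      the data \<open>us\<close> and \<open>cs\<close> from which \<open>\<psi>\<close> was
      formed.\<close>
    have "tadic_form v [(\<delta>, 2)] [] \<pi>"
      unfolding tadic_form_def
      using \<delta> rep_iso_trans[OF \<delta>(4) rep_iso_par_ind_singleton[OF smooth[OF \<delta>(3)]]]
      by (intro exI[of _ "[\<sigma>]"] exI[of _ "[]"]) simp
    then obtain us'' cs'' where perm: "mset us'' = mset [(\<delta>, 2)]" "mset cs'' = mset []"
      and us'': "list_all2 (\<lambda>(\<delta>, m) (\<delta>', m'). rep_iso \<delta> \<delta>' \<and> m = m') us us''"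
      and cs'': "list_all2 (\<lambda>(\<delta>, m, \<alpha>) (\<delta>', m', \<alpha>'). rep_iso \<delta> \<delta>' \<and> m = m' \<and> \<alpha> = \<alpha>') cs cs''"
      using dec unfolding tadic_decomposition_def by blast
    from perm have "us'' = [(\<delta>, 2)]" "cs'' = []" by simp_all
    then obtain \<delta>' where us: "us = [(\<delta>', 2)]" and cs: "cs = []" and iso: "rep_iso \<delta>' \<delta>"
      using us'' cs'' by (auto simp: list_all2_Cons2)
    have deg: "gl_deg \<delta>' = n"
      using iso \<delta>(2) unfolding rep_iso_def intertwiner_def by auto
    \<comment> \<open>Uniqueness identifies the discrete series only up to isomorphism, so the
      argument continues with \<open>\<delta>'\<close>, whose square integrability is part of the
      given decomposition.\<close>
    have "discrete_series v \<delta>'" using ds[of \<delta>' 2] us by simp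
    note llc = llc[OF this, unfolded deg]
    have "A_sum v llc us cs = (\<lambda>(x, h). kronecker (llc \<delta>' x) (sl2_irrep 2 h))"
      unfolding us cs A_sum_def by (simp del: diag_block_mat.simps)
    then show "X_distinguished v n \<psi> \<and> X_elliptic v n \<psi>"
      using llc \<psi> unfolding X_distinguished_def X_elliptic_def by auto
  qed
qed

end
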